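(* Let $f$ be a neutral scoring rule (defined for profiles over every finite candidate set) that is consistent with linearity, resistant to cloning, and satisfies inclusion clearance. Then there are functions $h^*,h:\mathbb Z_{\ge1}\to\mathbb R_{>0}$ such that $f$ is induced, on every finite candidate set $C$, by the cost function with $\mathrm{cost}(A,\triangleleft)=0$ if $A$ is an interval of $\triangleleft$, and otherwise $\mathrm{cost}(A,\triangleleft)=h^*(n)$ if $A$ contains both the leftmost and the rightmost candidate of $\triangleleft$ and $\mathrm{cost}(A,\triangleleft)=h(n)$ if not, where $n\ge1$ is the number of contiguous holes that $A$ creates in $\triangleleft$. Moreover $h^*(n)\le h(n)\le h^*(n+1)$ for all $n\ge1$.
   Context: Candidates come from a fixed infinite universe; rules are defined for profiles over every finite candidate set $C$. An approval ballot is a nonempty subset $A\subseteq C$; a profile over $C$ is a finite sequence of ballots. An axis is a strict linear order $\triangleleft$ on $C$; $\overleftarrow{\triangleleft}$ its reverse. A ballot $A$ is an interval of $\triangleleft$ if for all $a,b\in A$ and every $c$ with $a\triangleleft c\triangleleft b$ we have $c\in A$. The contiguous holes of $A$ in $\triangleleft$ are the maximal sets of consecutive (on $\triangleleft$) candidates not in $A$ that lie strictly between two candidates of $A$. A profile is linear if some axis makes all its ballots intervals; $\mathrm{con}(P)$ is the set of such axes. An axis rule maps each profile $P$ over $C$ to a nonempty set $f(P)$ of axes on $C$ closed under reversal. $f$ is a scoring rule if for every finite $C$ there is a cost function $\mathrm{cost}_C$ on (nonempty ballot, axis) pairs with values in $\mathbb R_{\ge0}$ and $f(P)=\arg\min_{\triangleleft}\sum_{A\in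 P}\mathrm{cost}_C(A,\triangleleft)$; it is then induced by these cost functions. $f$ is neutral if $f(\pi(P))=\pi(f(P))$ for every bijection $\pi:C\to C'$. $f$ is consistent with linearity if $f(P)=\mathrm{con}(P)$ for every linear profile. Two candidates $a,a'$ are clones in $P$ if for every $A\in P$, $a\in A$ iff $a'\in A$. $P_{-c}$ is the profile over $C\setminus\{c\}$ obtained by removing $c$ from every ballot (ballots becoming empty are discarded); $\triangleleft_{-c}$ is the restriction of $\triangleleft$. $f$ is resistant to cloning if for every profile $P$ with clones $a,a'$: (1) for every $\triangleleft\in f(P)$, $\triangleleft_{-a}\in f(P_{-a})$; and (2) for every $\triangleleft^*\in f(P_{-a})$ there is $\triangleleft\in f(P)$ with $\triangleleft_{-a}=\triangleleft^*$. $f$ satisfies inclusion clearance if for every profile $P$, letting $X$ be the set of candidates approved by no ballot of $P$, there is $\triangleleft\in f(P)$ such that no $A\in P$ has $y,z\in A$, $x\in X$ with $y\triangleleft x\triangleleft z$, and moreover every axis $\triangleleft'$ that has the same property (candidates of $X$ interfere with no ballot) and coincides with $\triangleleft$ on $C\setminus X$ is also in $f(P)$. *)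

theory Defs
  imports Complex_Main
begin

text \<open>An axis on a finite candidate set C is represented by the list of its
candidates from left to right (a distinct list whose set is C); the strict
linear order is "occurs strictly earlier in the list". Reversal is rev.\<close>

definition is_axis :: "'a set \<Rightarrow> 'a list \<Rightarrow> bool" where
  "is_axis C ax \<longleftrightarrow> distinct ax \<and> set ax = C"

definition axes :: "'a set \<Rightarrow> 'a list set" where
  "axes C = {ax. is_axis C ax}"

definition before :: "'a list \<Rightarrow> 'a \<Rightarrow> 'a \<Rightarrow> bool" where
  "before ax x y \<longleftrightarrow> (\<exists>i j. i < j \<and> j < length ax \<and> ax ! i = x \<and> ax ! j = y)"

definition is_profile :: "'a set \<Rightarrow> 'a set list \<Rightarrow> bool" where
  "is_profile C P \<longleftrightarrow> (\<forall>A \<in> set P. A \<noteq> {} \<and> A \<subseteq> C)"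

definition is_interval :: "'a set \<Rightarrow> 'a list \<Rightarrow> bool" where
  "is_interval A ax \<longleftrightarrow>
     (\<forall>a b c. a \<in> A \<longrightarrow> b \<in> A \<longrightarrow> before ax a c \<longrightarrow> before ax c b \<longrightarrow> c \<in> A)"

definition con :: "'a set \<Rightarrow> 'a set list \<Rightarrow> 'a list set" where
  "con C P = {ax. is_axis C ax \<and> (\<forall>A \<in> set P. is_interval A ax)}"

definition linear_profile :: "'a set \<Rightarrow> 'a set list \<Rightarrow> bool" where
  "linear_profile C P \<longleftrightarrow> con C P \<noteq> {}"

text \<open>Number of contiguous holes of A in ax: each hole is a maximal run of
non-members lying strictly between two members; it is counted by its first
position i (ax!(i-1) is a member, ax!i is not, and some member occurs later).\<close>
definition num_holes :: "'a set \<Rightarrow> 'a list \<Rightarrow> nat" where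
  "num_holes A ax = card {i. 0 < i \<and> i < length ax \<and> ax ! i \<notin> A \<and> ax ! (i - 1) \<in> A
                              \<and> (\<exists>j. i < j \<and> j < length ax \<and> ax ! j \<in> A)}"

type_synonym 'a axis_rule = "'a set \<Rightarrow> 'a set list \<Rightarrow> 'a list set"

definition is_axis_rule :: "'a axis_rule \<Rightarrow> bool" where
  "is_axis_rule f \<longleftrightarrow> (\<forall>C P. finite C \<longrightarrow> is_profile C P \<longrightarrow>
      f C P \<noteq> {} \<and> f C P \<subseteq> axes C \<and> (\<forall>ax \<in> f C P. rev ax \<in> f C P))"

definition total_cost :: "('a set \<Rightarrow> 'a list \<Rightarrow> real) \<Rightarrow> 'a set list \<Rightarrow> 'a list \<Rightarrow> real" where
  "total_cost cost P ax = (\<Sum>A\<leftarrow>P. cost A ax)"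

definition argmin_axes :: "('a set \<Rightarrow> 'a list \<Rightarrow> real) \<Rightarrow> 'a set \<Rightarrow> 'a set list \<Rightarrow> 'a list set" where
  "argmin_axes cost C P =
     {ax. is_axis C ax \<and> (\<forall>ax'. is_axis C ax' \<longrightarrow> total_cost cost P ax \<le> total_cost cost P ax')}"

definition induced_on :: "'a axis_rule \<Rightarrow> 'a set \<Rightarrow> ('a set \<Rightarrow> 'a list \<Rightarrow> real) \<Rightarrow> bool" where
  "induced_on f C cost \<longleftrightarrow> (\<forall>P. is_profile C P \<longrightarrow> f C P = argmin_axes cost C P)"

definition scoring_rule :: "'a axis_rule \<Rightarrow> bool" where
  "scoring_rule f \<longleftrightarrow> (\<forall>C. finite C \<longrightarrow>
     (\<exists>cost. (\<forall>A ax. A \<noteq> {} \<longrightarrow> A \<subseteq> C \<longrightarrow> is_axis C ax \<longrightarrow> cost A ax \<ge> 0)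
            \<and> induced_on f C cost))"

definition neutral :: "'a axis_rule \<Rightarrow> bool" where
  "neutral f \<longleftrightarrow> (\<forall>C C' \<pi> P. finite C \<longrightarrow> bij_betw \<pi> C C' \<longrightarrow> is_profile C P \<longrightarrow>
      f C' (map (\<lambda>A. \<pi> ` A) P) = (map \<pi>) ` f C P)"

definition consistent_with_linearity :: "'a axis_rule \<Rightarrow> bool" where
  "consistent_with_linearity f \<longleftrightarrow> (\<forall>C P. finite C \<longrightarrow> is_profile C P \<longrightarrow>
      linear_profile C P \<longrightarrow> f C P = con C P)"

definition clones :: "'a set list \<Rightarrow> 'a \<Rightarrow> 'a \<Rightarrow> bool" where
  "clones P a a' \<longleftrightarrow> (\<forall>A \<in> set P. a \<in> A \<longleftrightarrow> a' \<in> A)"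

definition remove_cand :: "'a \<Rightarrow> 'a set list \<Rightarrow> 'a set list" where
  "remove_cand c P = filter (\<lambda>A. A \<noteq> {}) (map (\<lambda>A. A - {c}) P)"

definition restrict_axis :: "'a \<Rightarrow> 'a list \<Rightarrow> 'a list" where
  "restrict_axis c ax = filter (\<lambda>x. x \<noteq> c) ax"

definition resistant_to_cloning :: "'a axis_rule \<Rightarrow> bool" where
  "resistant_to_cloning f \<longleftrightarrow> (\<forall>C P a a'. finite C \<longrightarrow> is_profile C P \<longrightarrow>
      a \<in> C \<longrightarrow> a' \<in> C \<longrightarrow> a \<noteq> a' \<longrightarrow> clones P a a' \<longrightarrow>
      (\<forall>ax \<in> f C P. restrict_axis a ax \<in> f (C - {a}) (remove_cand a P)) \<and>
      (\<forall>ax' \<in> f (C - {a}) (remove_cand a P). \<exists>ax \<in> f C P. restrict_axis a ax = ax'))"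

definition clears :: "'a set list \<Rightarrow> 'a set \<Rightarrow> 'a list \<Rightarrow> bool" where
  "clears P X ax \<longleftrightarrow> \<not> (\<exists>A \<in> set P. \<exists>y z x. y \<in> A \<and> z \<in> A \<and> x \<in> X \<and> before ax y x \<and> before ax x z)"

definition inclusion_clearance :: "'a axis_rule \<Rightarrow> bool" where
  "inclusion_clearance f \<longleftrightarrow> (\<forall>C P. finite C \<longrightarrow> is_profile C P \<longrightarrow>
      (let X = C - \<Union>(set P) in
        \<exists>ax \<in> f C P. clears P X ax \<and>
          (\<forall>ax'. is_axis C ax' \<longrightarrow> clears P X ax' \<longrightarrow>
                 filter (\<lambda>x. x \<notin> X) ax' = filter (\<lambda>x. x \<notin> X) ax \<longrightarrow> ax' \<in> f C P)))"

definition hole_cost :: "(nat \<Rightarrow> real) \<Rightarrow> (nat \<Rightarrow> real) \<Rightarrow> 'a set \<Rightarrow> 'a list \<Rightarrow> real" where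
  "hole_cost hs h A ax =
     (if is_interval A ax then 0
      else if hd ax \<in> A \<and> last ax \<in> A then hs (num_holes A ax)
      else h (num_holes A ax))"

end

theory Submission
  imports Defs
begin

text \<open>Subtracting minima, the cost of a ballot on an axis can be assumed to vanish exactly when the
ballot is an interval. Repeating a linear profile often enough restricts the choice to its consistent
axes; in this way one can compare the costs of any two axes that differ by swapping two neighbours,
and it follows that the normalised cost on at least three candidates is unique up to a positive
factor. By neutrality it then depends only on the 0/1-word of the ballot along the axis. Forcing two
clones to be adjacent shows that duplicating a letter multiplies all costs by a constant, so after
rescaling the cost depends only on the word with repeated letters contracted. Such a word is
determined by its number of holes and by which ends it contains; moving a never approved candidate
from one end of the axis to the other (inclusion clearance) identifies the three cases in which an
end is missing. The two inequalities come from one further application of cloning and of clearance,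
respectively.\<close>

section \<open>Words and holes\<close>

text \<open>The rule reveals only which axes minimise a total, so the cost of a losing axis is not
  directly visible. Two axes become comparable once a linear profile leaves only them and their
  reverses in the race; prefix and suffix ballots achieve this when the axes differ in one adjacent
  pair. What can be read off are signs of natural combinations of cost differences, hence each
  difference up to a positive factor that may a priori depend on the swap. The obstacle is to show
  that all swaps on \<open>C\<close> share one factor; then an axis on which the ballot is an
  interval supplies the zero of the scale. Below three candidates every ballot is an interval of
  every axis, so that case is treated apart. The scale is free on each candidate set separately:
  neutrality ties together sets of equal size, cloning ties size m to m + 1 with a constant of its
  own, which is why constants are multiplied up from 3. In the end \<open>hs n\<close> is
  \<open>G (star n)\<close> and \<open>h n\<close> is \<open>G (False # star n)\<close>. Cloning
  yields \<open>hs n \<le> h n\<close>, clearance yields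
  \<open>h n \<le> hs (n + 1)\<close>.\<close>

definition word :: "'a set \<Rightarrow> 'a list \<Rightarrow> bool list" where
  "word A ax = map (\<lambda>x. x \<in> A) ax"

fun holes :: "bool list \<Rightarrow> nat" where
  "holes (x # y # w) = (if x \<and> \<not> y \<and> True \<in> set w then 1 else 0) + holes (y # w)"
| "holes _ = 0"

lemma length_word [simp]: "length (word A ax) = length ax"
  by (simp add: word_def)

lemma word_append [simp]: "word A (xs @ ys) = word A xs @ word A ys"
  by (simp add: word_def)

lemma word_Cons [simp]: "word A (x # xs) = (x \<in> A) # word A xs"
  by (simp add: word_def)

lemma word_Nil [simp]: "word A [] = []"
  by (simp add: word_def)

lemma word_rev: "word A (rev xs) = rev (word A xs)"
  by (simp add: word_def rev_map)

lemma word_cong: "(\<And>x. x \<in> set xs \<Longrightarrow> x \<in> A \<longleftrightarrow> x \<in> B) \<Longrightarrow> word A xs = word B xs"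
  by (simp add: word_def)

lemma True_in_set_word: "True \<in> set (word A ax) \<longleftrightarrow> A \<inter> set ax \<noteq> {}"
  by (auto simp: word_def)

lemma ex_word:
  assumes "distinct ax" "length w = length ax"
  obtains A where "A \<subseteq> set ax" "word A ax = w"
proof
  let ?A = "{ax ! i | i. i < length ax \<and> w ! i}"
  show "?A \<subseteq> set ax" by auto
  show "word ?A ax = w"
    using assms by (auto simp: word_def nth_eq_iff_index_eq intro!: nth_equalityI)
qed

lemma num_holes_word: "num_holes A ax = holes (word A ax)"
proof (induction ax rule: induct_list012)
  case (3 x y zs)
  define H where "H ax = {i. 0 < i \<and> i < length ax \<and> ax ! i \<notin> A \<and> ax ! (i - 1) \<in> A
                              \<and> (\<exists>j. i < j \<and> j < length ax \<and> ax ! j \<in> A)}" for ax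
  let ?b = "x \<in> A \<and> y \<notin> A \<and> True \<in> set (word A zs)"
  have ex: "(\<exists>j. Suc 0 < j \<and> j < length (x # y # zs) \<and> (x # y # zs) ! j \<in> A) \<longleftrightarrow> True \<in> set (word A zs)"
  proof
    assume "\<exists>j. Suc 0 < j \<and> j < length (x # y # zs) \<and> (x # y # zs) ! j \<in> A"
    then obtain j where "Suc 0 < j" "j < length (x # y # zs)" "(x # y # zs) ! j \<in> A" by auto
    then have "j - 2 < length zs" "zs ! (j - 2) \<in> A"
      by (auto simp: nth_Cons split: nat.splits)
    then show "True \<in> set (word A zs)" by (auto simp: True_in_set_word)
  next
    assume "True \<in> set (word A zs)"
    then obtain k where "k < length zs" "zs ! k \<in> A" by (auto simp: word_def in_set_conv_nth)
    then show "\<exists>j. Suc 0 < j \<and> j < length (x # y # zs) \<and> (x # y # zs) ! j \<in> A"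
      by (intro exI[of _ "Suc (Suc k)"]) auto
  qed
  \<comment> \<open>Hole starts at positions from 2 on are those of the tail shifted by one; only
    position 1 can be new.\<close>
  have "i \<in> H (x # y # zs) \<longleftrightarrow> i \<in> (if ?b then {1} else {}) \<union> Suc ` H (y # zs)" for i
  proof (cases "i \<le> 1")
    case True
    then have "i = 0 \<or> i = 1" by auto
    moreover have "Suc 0 \<in> H (x # y # zs) \<longleftrightarrow> ?b"
      unfolding H_def using ex by auto
    ultimately show ?thesis by (auto simp: H_def)
  next
    case False
    then obtain k where k: "i = Suc (Suc k)" by (metis One_nat_def not0_implies_Suc not_less_eq_eq le0)
    have "(\<exists>j>i. j < length (x # y # zs) \<and> (x # y # zs) ! j \<in> A) \<longleftrightarrow>
        (\<exists>j>Suc k. j < length (y # zs) \<and> (y # zs) ! j \<in> A)" (is "?l = ?r")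
    proof
      assume ?l
      then obtain j where "j > i" "j < length (x # y # zs)" "(x # y # zs) ! j \<in> A" by auto
      then show ?r using k by (intro exI[of _ "j - 1"]) auto
    next
      assume ?r
      then obtain j where "j > Suc k" "j < length (y # zs)" "(y # zs) ! j \<in> A" by auto
      then show ?l using k by (intro exI[of _ "Suc j"]) auto
    qed
    then have "i \<in> H (x # y # zs) \<longleftrightarrow> Suc k \<in> H (y # zs)"
      unfolding H_def using k by simp
    then show ?thesis using k by auto
  qed
  then have eq: "H (x # y # zs) = (if ?b then {1} else {}) \<union> Suc ` H (y # zs)" by blast
  have "finite (H (y # zs))" by (auto simp: H_def)
  moreover have "1 \<notin> Suc ` H (y # zs)" by (auto simp: H_def)
  ultimately have "card (H (x # y # zs)) = (if ?b then 1 else 0) + card (H (y # zs))"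
    unfolding eq by (auto simp: card_image)
  moreover have "num_holes A ax = card (H ax)" for ax by (simp add: num_holes_def H_def)
  ultimately show ?case using 3 by simp
qed (simp_all add: num_holes_def)

lemma is_interval_iff_nth:
  assumes "distinct ax"
  shows "is_interval A ax \<longleftrightarrow>
    (\<forall>i k j. i < k \<longrightarrow> k < j \<longrightarrow> j < length ax \<longrightarrow> ax ! i \<in> A \<longrightarrow> ax ! j \<in> A \<longrightarrow> ax ! k \<in> A)"
    (is "_ \<longleftrightarrow> ?R")
proof
  assume "is_interval A ax"
  then show ?R unfolding is_interval_def before_def using order.strict_trans by blast
next
  assume ?R
  then show "is_interval A ax"
    unfolding is_interval_def before_def using assms nth_eq_iff_index_eq
    by (smt (verit) order.strict_trans)
qed

lemma is_interval_iff_holes: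
  assumes "distinct ax"
  shows "is_interval A ax \<longleftrightarrow> holes (word A ax) = 0"
proof -
  let ?H = "{i. 0 < i \<and> i < length ax \<and> ax ! i \<notin> A \<and> ax ! (i - 1) \<in> A
                              \<and> (\<exists>j. i < j \<and> j < length ax \<and> ax ! j \<in> A)}"
  have "finite ?H" by auto
  then have "holes (word A ax) = 0 \<longleftrightarrow> ?H = {}"
    by (simp add: num_holes_word[symmetric] num_holes_def)
  moreover have "is_interval A ax" if H: "?H = {}"
    unfolding is_interval_iff_nth[OF assms]
  proof (intro allI impI, rule ccontr)
    fix i k j assume *: "i < k" "k < j" "j < length ax" "ax ! i \<in> A" "ax ! j \<in> A" "ax ! k \<notin> A"
    \<comment> \<open>The first non-member after position \<open>i\<close> has a member just before
      it, so it starts a hole.\<close>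
    define l where "l = (LEAST l. i < l \<and> ax ! l \<notin> A)"
    have l: "i < l" "ax ! l \<notin> A" "l \<le> k"
      using LeastI[of "\<lambda>l. i < l \<and> ax ! l \<notin> A" k] Least_le[of "\<lambda>l. i < l \<and> ax ! l \<notin> A" k] *
      by (auto simp: l_def)
    have "ax ! (l - 1) \<in> A"
    proof (cases "l - 1 = i")
      case False
      then have "i < l - 1" "l - 1 < l" using l by auto
      then show ?thesis using not_less_Least[of "l - 1" "\<lambda>l. i < l \<and> ax ! l \<notin> A"] by (auto simp: l_def)
    qed (use * in auto)
    moreover have "l < j" "l < length ax" "0 < l" using l * by auto
    ultimately have "l \<in> ?H" using l * by blast
    then show False using H by blast
  qed
  moreover have "?H = {}" if "is_interval A ax"
  proof (rule ccontr)
    assume "?H \<noteq> {}"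
    then obtain i j where "0 < i" "ax ! i \<notin> A" "ax ! (i - 1) \<in> A" "i < j" "j < length ax" "ax ! j \<in> A"
      by auto
    then show False using that is_interval_iff_nth[OF assms, of A]
      by (metis diff_less less_numeral_extra(1))
  qed
  ultimately show ?thesis by blast
qed

lemma holes_Cons_False [simp]: "holes (False # w) = holes w"
  by (cases w) auto

lemma holes_Cons_True_True [simp]: "holes (True # True # w) = holes (True # w)"
  by simp

lemma holes_snoc_False [simp]: "holes (w @ [False]) = holes w"
  by (induction w rule: holes.induct) auto

lemma holes_remdups_adj: "holes (remdups_adj w) = holes w"
proof (induction w rule: remdups_adj.induct)
  case (3 x y xs)
  have "remdups_adj (y # xs) = y # tl (remdups_adj (y # xs))" by (simp add: remdups_adj_Cons')
  moreover have "set (remdups_adj (y # xs)) = set (y # xs)" by simp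
  ultimately have "x \<and> \<not> y \<longrightarrow> True \<in> set (tl (remdups_adj (y # xs))) \<longleftrightarrow> True \<in> set xs"
    by (metis (full_types) list.set_intros(2) set_ConsD)
  with 3 show ?case
    by (smt (verit, del_insts) \<open>remdups_adj (y # xs) = y # tl (remdups_adj (y # xs))\<close> holes.simps(1) holes_Cons_False holes_Cons_True_True remdups_adj.simps(3))
qed auto

lemma is_interval_rev: "is_interval A (rev ax) \<longleftrightarrow> is_interval A ax"
proof -
  have *: "is_interval A (rev ax)" if "is_interval A ax" for ax :: "'a list"
  proof -
    have b: "before ax y x" if xy: "before (rev ax) x y" for x y
    proof -
      obtain i j where ij: "i < j" "j < length ax" "rev ax ! i = x" "rev ax ! j = y"
        using xy by (auto simp: before_def)
      then show ?thesis unfolding before_def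
        by (intro exI[of _ "length ax - Suc j"] exI[of _ "length ax - Suc i"]) (auto simp: rev_nth)
    qed
    show ?thesis using \<open>is_interval A ax\<close> unfolding is_interval_def by (meson b)
  qed
  show ?thesis using *[of ax] *[of "rev ax"] by auto
qed

section \<open>Axes and intervals\<close>

lemma is_axis_rev [simp]: "is_axis C (rev ax) \<longleftrightarrow> is_axis C ax"
  by (simp add: is_axis_def)

lemma is_axis_length: "is_axis C ax \<Longrightarrow> length ax = card C"
  by (auto simp: is_axis_def distinct_card)

lemma finite_axes: "finite C \<Longrightarrow> finite {ax. is_axis C ax}"
  by (rule finite_subset[OF _ finite_lists_length_eq[of C "card C"]])
    (auto simp: is_axis_def distinct_card)

lemma before_append_Cons: "s \<in> set u \<Longrightarrow> before (u @ x # v) s x"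
  unfolding before_def
  by (metis (no_types, lifting) in_set_conv_nth length_append less_add_same_cancel1 length_pos_if_in_set list.set_intros(1) nth_append nth_append_length)

lemma before_append_Cons': "t \<in> set v \<Longrightarrow> before (u @ x # v) x t"
proof -
  assume "t \<in> set v"
  then obtain k where "k < length v" "v ! k = t" by (auto simp: in_set_conv_nth)
  then show ?thesis unfolding before_def
    by (intro exI[of _ "length u"] exI[of _ "length u + Suc k"]) (auto simp: nth_append)
qed

lemma is_interval_take_drop:
  assumes "distinct ax"
  shows "is_interval (set (take i ax)) ax" "is_interval (set (drop i ax)) ax"
proof -
  have t: "k < length ax \<Longrightarrow> ax ! k \<in> set (take i ax) \<longleftrightarrow> k < i" for k
    using assms by (auto simp: in_set_conv_nth nth_eq_iff_index_eq)
  have d: "k < length ax \<Longrightarrow> ax ! k \<in> set (drop i ax) \<longleftrightarrow> \<not> k < i" for k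
    using t[of k] assms
    by (metis Un_iff append_take_drop_id distinct_append disjoint_iff nth_mem set_append)
  show "is_interval (set (take i ax)) ax" "is_interval (set (drop i ax)) ax"
    unfolding is_interval_iff_nth[OF assms]
    using t d by (meson order.strict_trans, meson order.strict_trans)
qed

lemma ex_is_interval_axis:
  assumes "finite C" "A \<subseteq> C"
  obtains ax where "is_axis C ax" "is_interval A ax"
proof -
  obtain xs ys where xs: "set xs = A" "distinct xs" and ys: "set ys = C - A" "distinct ys"
    using assms by (metis finite_Diff finite_distinct_list finite_subset)
  then have "is_interval A (xs @ ys)"
    using is_interval_take_drop(1)[of "xs @ ys" "length xs"] by auto
  moreover have "is_axis C (xs @ ys)" using xs ys assms by (auto simp: is_axis_def)
  ultimately show ?thesis using that by blast
qed

lemma is_interval_filter: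
  assumes "is_interval A ax"
  shows "is_interval (A \<inter> {x. p x}) (filter p ax)"
proof -
  have "before (filter p ax) x y \<Longrightarrow> before ax x y \<and> p x \<and> p y" for x y
  proof (induction ax)
    case Nil
    then show ?case by (auto simp: before_def)
  next
    case (Cons a ax)
    have up: "before (a # ax) x y" if "before ax x y"
      using that unfolding before_def by (metis Suc_less_eq length_Cons nth_Cons_Suc)
    show ?case
    proof (cases "p a")
      case False
      then show ?thesis using Cons up by auto
    next
      case True
      from Cons.prems True obtain i j where ij: "i < j" "j < Suc (length (filter p ax))"
        "(a # filter p ax) ! i = x" "(a # filter p ax) ! j = y"
        by (auto simp: before_def)
      show ?thesis
      proof (cases i)
        case 0
        then have "x = a" "y \<in> set (filter p ax)"
          using ij nth_mem[of "j - 1" "filter p ax"] by (auto simp: nth_Cons')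
        then show ?thesis using True before_append_Cons'[of y ax "[]" a] by auto
      next
        case (Suc k)
        then have "before (filter p ax) x y" using ij unfolding before_def
          by (intro exI[of _ k] exI[of _ "j - 1"]) auto
        then show ?thesis using Cons.IH up by auto
      qed
    qed
  qed
  then show ?thesis using assms unfolding is_interval_def by blast
qed

lemma is_interval_restrict_axis:
  "is_interval A ax \<Longrightarrow> is_interval (A - {x}) (restrict_axis x ax)"
  using is_interval_filter[of A ax "\<lambda>y. y \<noteq> x"]
  by (simp add: restrict_axis_def Diff_eq Compl_eq)

lemma is_axis_restrict_axis: "is_axis C ax \<Longrightarrow> is_axis (C - {x}) (restrict_axis x ax)"
  by (auto simp: is_axis_def restrict_axis_def)

lemma restrict_axis_notin: "x \<notin> set ax \<Longrightarrow> restrict_axis x ax = ax"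
  by (auto simp: restrict_axis_def intro: filter_True)

lemma restrict_axis_append [simp]: "restrict_axis x (u @ v) = restrict_axis x u @ restrict_axis x v"
  by (simp add: restrict_axis_def)

lemma restrict_axis_Cons [simp]:
  "restrict_axis x (y # v) = (if x = y then restrict_axis x v else y # restrict_axis x v)"
  by (simp add: restrict_axis_def)

text \<open>How non-interference becomes a position: if \<open>x\<close> stood inside, the first and
  the last of the remaining candidates would enclose it.\<close>

lemma extreme_if_outside:
  assumes "distinct ax" "x \<in> set ax"
    and "\<not> (before ax (hd (restrict_axis x ax)) x \<and> before ax x (last (restrict_axis x ax)))"
  shows "ax = x # restrict_axis x ax \<or> ax = restrict_axis x ax @ [x]"
proof -
  obtain u v where ax: "ax = u @ x # v" using assms(2) by (meson split_list)
  then have r: "restrict_axis x ax = u @ v" using assms(1) by (simp add: restrict_axis_notin)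
  have "u = [] \<or> v = []"
  proof (rule ccontr)
    assume "\<not> (u = [] \<or> v = [])"
    then have "hd (u @ v) \<in> set u" "last (u @ v) \<in> set v" by auto
    then show False using assms(3) ax r before_append_Cons before_append_Cons' by metis
  qed
  then show ?thesis using ax r by auto
qed

text \<open>Interval ballots speak about betweenness, the forcing arguments about prefix sets. The
  translation works because no outsider can occur before an interval that starts at the left end is
  complete.\<close>

lemma is_interval_initial:
  assumes "distinct ax" "is_interval A ax" "A \<subseteq> set ax" "ax \<noteq> []" "hd ax \<in> A"
  shows "set (take (card A) ax) = A"
proof -
  let ?t = "takeWhile (\<lambda>x. x \<in> A) ax" and ?d = "dropWhile (\<lambda>x. x \<in> A) ax"
  have "y \<in> set ?t" if y: "y \<in> A" for y
  proof (rule ccontr)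
    assume n: "y \<notin> set ?t"
    then have yd: "y \<in> set ?d" using assms y
      by (metis Un_iff in_mono set_append takeWhile_dropWhile_id)
    then obtain c v where d: "?d = c # v" by (cases ?d) auto
    then have c: "c \<notin> A" by (metis dropWhile_eq_Cons_conv)
    have ax: "ax = ?t @ c # v" using d by (metis takeWhile_dropWhile_id)
    have "hd ax \<in> set ?t" using assms by (cases ax) auto
    then have "before ax (hd ax) c" using ax before_append_Cons by metis
    moreover have "y \<in> set v" using yd d c y by auto
    then have "before ax c y" using ax before_append_Cons' by metis
    ultimately show False using assms(2,5) y c unfolding is_interval_def by blast
  qed
  then have eq: "set ?t = A" by (auto dest: set_takeWhileD)
  have "distinct ?t" using assms(1) by simp
  then have "length ?t = card A" using eq by (metis distinct_card)
  then have "take (card A) ax = ?t" by (metis takeWhile_eq_take)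
  then show ?thesis using eq by simp
qed

text \<open>A prefix ballot alone could sit anywhere on another axis. Together with the
  complementary suffix ballot it forces a cut, since of two complementary intervals each holds one
  end. \<open>I\<close> lists the places where \<open>Y\<close> is cut; the order inside the blocks
  between consecutive cuts stays free.\<close>

definition cuts :: "'a list \<Rightarrow> nat list \<Rightarrow> 'a set list" where
  "cuts Y I = map (\<lambda>i. set (take i Y)) I @ map (\<lambda>i. set (drop i Y)) I"

lemma is_profile_cuts:
  assumes "\<forall>i \<in> set I. 0 < i \<and> i < length Y" "set Y \<subseteq> C"
  shows "is_profile C (cuts Y I)"
  using assms unfolding is_profile_def cuts_def
  by (auto dest: in_set_takeD in_set_dropD)

lemma con_cutsI:
  assumes "is_axis C ax" "is_axis C Y" "\<forall>i \<in> set I. set (take i ax) = set (take i Y)"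
  shows "ax \<in> con C (cuts Y I)"
proof -
  have d: "set (drop i Z) = C - set (take i Z)" if "is_axis C Z" for i Z
  proof -
    have "set (take i Z) \<union> set (drop i Z) = C" "set (take i Z) \<inter> set (drop i Z) = {}"
      using that unfolding is_axis_def
      by (metis append_take_drop_id set_append, metis append_take_drop_id distinct_append)
    then show ?thesis by blast
  qed
  have eq: "set (drop i ax) = set (drop i Y)" if "i \<in> set I" for i
    by (metis d[OF assms(1)] d[OF assms(2)] assms(3) that)
  have "is_interval A ax" if "A \<in> set (cuts Y I)" for A
  proof -
    have "\<exists>i. A = set (take i ax) \<or> A = set (drop i ax)"
      using that assms(3) eq unfolding cuts_def by fastforce
    then show ?thesis using is_interval_take_drop assms(1) unfolding is_axis_def by blast
  qed
  then show ?thesis using assms(1) by (simp add: con_def)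
qed

lemma con_rev: "ax \<in> con C L \<Longrightarrow> rev ax \<in> con C L"
  by (simp add: con_def is_interval_rev)

text \<open>Each cut on its own is respected by \<open>ax\<close> or by its reverse; as the prefixes
  of \<open>Y\<close> are nested, one orientation must serve all cuts.\<close>

lemma con_cutsD:
  assumes "is_axis C Y" "\<forall>i \<in> set I. 0 < i \<and> i < length Y" "ax \<in> con C (cuts Y I)"
  shows "(\<forall>i \<in> set I. set (take i ax) = set (take i Y)) \<or>
    (\<forall>i \<in> set I. set (take i (rev ax)) = set (take i Y))"
proof -
  have ax: "distinct ax" "set ax = C" and Y: "distinct Y" "set Y = C"
    using assms by (auto simp: con_def is_axis_def)
  have len: "length ax = length Y" using ax Y by (metis distinct_card)
  define p where "p b i \<longleftrightarrow> set (take i (if b then ax else rev ax)) = set (take i Y)" for b i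
  have one: "p True i \<or> p False i" if i: "i \<in> set I" for i
  proof -
    have i0: "0 < i" "i < length Y" using assms(2) i by auto
    have int: "is_interval (set (take i Y)) ax" "is_interval (set (drop i Y)) ax"
      using assms(3) i by (auto simp: con_def cuts_def)
    have card: "card (set (take i Y)) = i" "card (set (drop i Y)) = length Y - i"
      using Y i0 by (auto simp: distinct_card)
    have ne: "ax \<noteq> []" using len i0 by auto
    have sub: "set (take i Y) \<subseteq> set ax" "set (drop i Y) \<subseteq> set ax"
      using ax Y by (auto dest: in_set_takeD in_set_dropD)
    have un: "set (take i Y) \<union> set (drop i Y) = set ax" "set (take i Y) \<inter> set (drop i Y) = {}"
      using ax Y by (metis append_take_drop_id set_append, metis append_take_drop_id distinct_append Y(1))
    show ?thesis
    proof (cases "hd ax \<in> set (take i Y)")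
      case True
      then show ?thesis
        using is_interval_initial[OF ax(1) int(1) sub(1) ne] card by (simp add: p_def)
    next
      case False
      then have "hd ax \<in> set (drop i Y)" using un ne by (metis Un_iff hd_in_set)
      then have e: "set (take (length Y - i) ax) = set (drop i Y)"
        using is_interval_initial[OF ax(1) int(2) sub(2) ne] card by simp
      have "set (take i (rev ax)) = set (drop (length Y - i) ax)"
        by (simp add: take_rev len)
      moreover have "set (take (length Y - i) ax) \<union> set (drop (length Y - i) ax) = set ax"
        "set (take (length Y - i) ax) \<inter> set (drop (length Y - i) ax) = {}"
        using ax by (metis append_take_drop_id set_append, metis append_take_drop_id distinct_append ax(1))
      ultimately show ?thesis using e un unfolding p_def by auto
    qed
  qed
  \<comment> \<open>Opposite orientations at \<open>i \<le> j\<close> would put the first candidate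
    of one orientation both among the first \<open>j\<close> candidates of the other and behind
    them.\<close>
  have two: False if "p b i" "p (\<not> b) j" "i \<le> j" "i \<in> set I" "j \<in> set I" for b i j
  proof -
    let ?a = "if b then ax else rev ax"
    have a: "distinct ?a" "length ?a = length Y" "?a \<noteq> []"
      using ax len assms(2) that by auto
    have "hd ?a \<in> set (take i ?a)" using a assms(2) that(4) by (cases ?a; cases i) auto
    also have "\<dots> = set (take i Y)" using that by (simp add: p_def)
    also have "\<dots> \<subseteq> set (take j Y)" using that by (simp add: set_take_subset_set_take)
    also have "\<dots> = set (take j (rev ?a))" using that by (auto simp: p_def)
    finally have "hd ?a \<in> set (take j (rev ?a))" .
    moreover have "hd ?a \<in> set (drop j (rev ?a))"
      using a assms(2) that(5)
      by (metis drop_eq_Nil last_drop last_in_set last_rev length_rev linorder_not_le)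
    moreover have "set (take j (rev ?a)) \<inter> set (drop j (rev ?a)) = {}"
      using a(1) by (metis append_take_drop_id distinct_append distinct_rev)
    ultimately show False by blast
  qed
  show ?thesis
  proof (cases "\<forall>i \<in> set I. p True i")
    case False
    then obtain i where i: "i \<in> set I" "p False i" using one by blast
    have "p False j" if "j \<in> set I" for j
      using one[OF that] two[of False i j] two[of True j i] i that by (metis (full_types) nle_le)
    then show ?thesis by (auto simp: p_def)
  qed (auto simp: p_def)
qed

lemma nth_eq_if_take_eq:
  assumes "distinct ax" "distinct Y" "i < length ax" "i < length Y"
    "set (take i ax) = set (take i Y)" "set (take (Suc i) ax) = set (take (Suc i) Y)"
  shows "ax ! i = Y ! i"
proof -
  have "ax ! i \<in> set (take (Suc i) Y)" using assms by (metis last_in_set last_snoc snoc_eq_iff_butlast take_Suc_conv_app_nth)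
  moreover have "ax ! i \<notin> set (take i Y)" using assms
    by (metis distinct_take not_distinct_conv_prefix take_Suc_conv_app_nth)
  ultimately show ?thesis using assms(4) by (simp add: take_Suc_conv_app_nth)
qed

section \<open>Normalised costs and forcing profiles\<close>

definition normal_cost :: "'a axis_rule \<Rightarrow> 'a set \<Rightarrow> ('a set \<Rightarrow> 'a list \<Rightarrow> real) \<Rightarrow> bool" where
  "normal_cost f C c \<longleftrightarrow>
     (\<forall>A ax. A \<noteq> {} \<longrightarrow> A \<subseteq> C \<longrightarrow> is_axis C ax \<longrightarrow>
        0 \<le> c A ax \<and> (c A ax = 0 \<longleftrightarrow> is_interval A ax)) \<and>
     induced_on f C c"

lemma normal_costD:
  assumes "normal_cost f C c" "A \<noteq> {}" "A \<subseteq> C" "is_axis C ax"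
  shows "0 \<le> c A ax" "c A ax = 0 \<longleftrightarrow> is_interval A ax"
  using assms by (auto simp: normal_cost_def)

lemma total_cost_simps [simp]:
  "total_cost c [] ax = 0"
  "total_cost c (A # P) ax = c A ax + total_cost c P ax"
  "total_cost c (P @ Q) ax = total_cost c P ax + total_cost c Q ax"
  by (simp_all add: total_cost_def)

lemma total_cost_concat_replicate:
  "total_cost c (concat (replicate K L)) ax = real K * total_cost c L ax"
  by (induction K) (auto simp: algebra_simps)

lemma is_profile_simps [simp]:
  "is_profile C []"
  "is_profile C (A # P) \<longleftrightarrow> A \<noteq> {} \<and> A \<subseteq> C \<and> is_profile C P"
  "is_profile C (P @ Q) \<longleftrightarrow> is_profile C P \<and> is_profile C Q"
  by (auto simp: is_profile_def)

lemma total_cost_nonneg: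
  assumes "normal_cost f C c" "is_profile C P" "is_axis C ax"
  shows "0 \<le> total_cost c P ax"
  using assms by (induction P) (auto simp: normal_cost_def)

lemma total_cost_eq_0_iff:
  assumes "normal_cost f C c" "is_profile C P" "is_axis C ax"
  shows "total_cost c P ax = 0 \<longleftrightarrow> ax \<in> con C P"
  using assms(2)
proof (induction P)
  case (Cons A P)
  then have "0 \<le> total_cost c P ax" "0 \<le> c A ax" "c A ax = 0 \<longleftrightarrow> is_interval A ax"
    using assms total_cost_nonneg[of f C c P ax] by (auto simp: normal_cost_def)
  then show ?case using Cons by (auto simp: con_def add_nonneg_eq_0_iff)
qed (use assms in \<open>auto simp: con_def\<close>)

lemma con_cong: "set P = set Q \<Longrightarrow> con C P = con C Q"
  by (simp add: con_def)

lemma is_profile_cong: "set P = set Q \<Longrightarrow> is_profile C P \<longleftrightarrow> is_profile C Q"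
  by (simp add: is_profile_def)

lemma mem_rule_iff:
  assumes "normal_cost f C c" "is_profile C P"
  shows "ax \<in> f C P \<longleftrightarrow> is_axis C ax \<and>
    (\<forall>ax'. is_axis C ax' \<longrightarrow> total_cost c P ax \<le> total_cost c P ax')"
  using assms by (simp add: normal_cost_def induced_on_def argmin_axes_def)

text \<open>Enough copies of \<open>L\<close> make every axis outside \<open>con C L\<close> dearer
  than a fixed consistent one. The conclusion mentions \<open>f\<close> and not \<open>c\<close>, so
  a \<open>Q\<close> found with one normal cost can be used with every other.\<close>

lemma ex_forcing_profile:
  assumes "finite C" "normal_cost f C c" "is_profile C L" "con C L \<noteq> {}" "is_profile C P"
  obtains Q where "set Q = set L" "f C (Q @ P) \<subseteq> con C L"
proof -
  obtain ax0 where ax0: "ax0 \<in> con C L" using assms by blast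
  \<comment> \<open>The number of copies that makes up for \<open>P\<close> on one axis; the sum
    over the finitely many axes is a common bound and \<open>Suc\<close> makes it strict. On
    consistent axes the division by 0 yields the harmless value 0.\<close>
  define k where "k ax = nat \<lceil>total_cost c P ax0 / total_cost c L ax\<rceil>" for ax
  define K where "K = Suc (\<Sum>ax \<in> {ax. is_axis C ax}. k ax)"
  define Q where "Q = concat (replicate K L)"
  have Q: "set Q = set L" by (auto simp: Q_def K_def)
  then have prof: "is_profile C (Q @ P)" using assms is_profile_cong[of Q L] by auto
  have "ax \<in> con C L" if "ax \<in> f C (Q @ P)" for ax
  proof (rule ccontr)
    assume n: "ax \<notin> con C L"
    have ax: "is_axis C ax" and le: "total_cost c (Q @ P) ax \<le> total_cost c (Q @ P) ax0"
      using that mem_rule_iff[OF assms(2) prof] ax0 by (auto simp: con_def)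
    have "0 < total_cost c L ax"
      using total_cost_eq_0_iff[OF assms(2,3) ax] total_cost_nonneg[OF assms(2,3) ax] n by linarith
    moreover have "k ax \<le> (\<Sum>ax \<in> {ax. is_axis C ax}. k ax)"
      using ax finite_axes[OF assms(1)] by (intro member_le_sum) auto
    then have "real (k ax) < real K" unfolding K_def by linarith
    then have "total_cost c P ax0 / total_cost c L ax < real K" unfolding k_def by linarith
    ultimately have "total_cost c P ax0 < real K * total_cost c L ax"
      by (simp add: pos_divide_less_eq)
    moreover have "total_cost c L ax0 = 0"
      using ax0 total_cost_eq_0_iff[OF assms(2,3), of ax0] by (simp add: con_def)
    ultimately show False
      using le total_cost_nonneg[OF assms(2,5) ax] by (simp add: Q_def total_cost_concat_replicate)
  qed
  then show ?thesis using that Q by blast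
qed

section \<open>Proportionality from agreeing signs\<close>

lemma ex_nat_ratio_between:
  fixes r s :: real
  assumes "0 \<le> r" "r < s"
  obtains p q :: nat where "0 < q" "r * q < p" "p < s * q"
proof -
  obtain q :: nat where q: "1 < real q * (s - r)"
    using reals_Archimedean3[of "s - r"] assms by auto
  have "0 < q" using q by (cases q) auto
  define p where "p = nat (\<lfloor>r * q\<rfloor> + 1)"
  have "real p = \<lfloor>r * q\<rfloor> + 1" using assms by (simp add: p_def)
  then have "r * q < p" "p \<le> r * q + 1" by linarith+
  moreover have "r * q + 1 < s * q" using q by (simp add: algebra_simps)
  ultimately show ?thesis using that[OF \<open>0 < q\<close>, of p] by linarith
qed

text \<open>If the ratios were in the wrong order, a fraction \<open>p / q\<close> between them
  would make \<open>p\<close> copies of \<open>A\<close> and \<open>q\<close> copies of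
  \<open>B\<close> a list with positive sum under \<open>d\<close> and negative sum under
  \<open>d'\<close>. Multiplicities are natural numbers, whence the opposite signs of
  \<open>d A\<close> and \<open>d B\<close>.\<close>

lemma proportional_if_same_signs_aux:
  fixes d d' :: "'b \<Rightarrow> real"
  assumes pos: "\<And>P. set P \<subseteq> D \<Longrightarrow> 0 < (\<Sum>A\<leftarrow>P. d A) \<longleftrightarrow> 0 < (\<Sum>A\<leftarrow>P. d' A)"
    and A: "A \<in> D" "0 < d A" and B: "B \<in> D" "d B \<le> 0"
  shows "- d' B / d' A \<le> - d B / d A"
proof (rule ccontr)
  assume "\<not> ?thesis"
  then have lt: "- d B / d A < - d' B / d' A" by simp
  have ge: "0 \<le> - d B / d A" using A B by (simp add: divide_nonpos_pos)
  obtain p q :: nat where q: "0 < q" "(- d B / d A) * q < p" "p < (- d' B / d' A) * q"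
    by (rule ex_nat_ratio_between[OF ge lt])
  let ?P = "replicate p A @ replicate q B"
  have d'A: "0 < d' A" using pos[of "[A]"] A by simp
  have "0 < (\<Sum>A\<leftarrow>?P. d A)" using q A
    by (simp add: sum_list_replicate field_simps)
  moreover have "(\<Sum>A\<leftarrow>?P. d' A) < 0" using q d'A
    by (simp add: sum_list_replicate field_simps)
  moreover have "set ?P \<subseteq> D" using A B by (auto simp: set_replicate_conv_if)
  ultimately show False using pos[of ?P] by linarith
qed

text \<open>The auxiliary inequality relates elements of opposite sign only: \<open>A\<close> fixes
  the factor on nonpositive values, \<open>B\<close> fixes it on nonnegative ones, and the two
  factors agree at \<open>B\<close>.\<close>

lemma proportional_if_same_signs:
  fixes d d' :: "'b \<Rightarrow> real"
  assumes pos: "\<And>P. set P \<subseteq> D \<Longrightarrow> 0 < (\<Sum>A\<leftarrow>P. d A) \<longleftrightarrow> 0 < (\<Sum>A\<leftarrow>P. d' A)"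
    and neg: "\<And>P. set P \<subseteq> D \<Longrightarrow> (\<Sum>A\<leftarrow>P. d A) < 0 \<longleftrightarrow> (\<Sum>A\<leftarrow>P. d' A) < 0"
    and A: "A \<in> D" "0 < d A" and B: "B \<in> D" "d B < 0"
  obtains \<alpha> where "0 < \<alpha>" "\<And>E. E \<in> D \<Longrightarrow> d' E = \<alpha> * d E"
proof -
  have d'A: "0 < d' A" using pos[of "[A]"] A by simp
  have d'B: "d' B < 0" using neg[of "[B]"] B by simp
  have sgn: "0 < d E \<longleftrightarrow> 0 < d' E" "d E < 0 \<longleftrightarrow> d' E < 0" if "E \<in> D" for E
    using pos[of "[E]"] neg[of "[E]"] that by auto
  have nonpos: "d' E = d' A / d A * d E" if "E \<in> D" "d E \<le> 0" for E
  proof -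
    have "- d' E / d' A \<le> - d E / d A"
      using proportional_if_same_signs_aux[of D d d' A E] pos A that by blast
    moreover have "- d E / d A \<le> - d' E / d' A"
      using proportional_if_same_signs_aux[of D d' d A E] pos A d'A that sgn[OF that(1)]
      by (meson linorder_not_less)
    ultimately have "d E / d A = d' E / d' A" by simp
    then show ?thesis using A d'A by (simp add: field_simps)
  qed
  have uminus: "(\<Sum>A\<leftarrow>P. - g A) = - (\<Sum>A\<leftarrow>P. g A)" for P and g :: "'b \<Rightarrow> real"
    by (simp add: uminus_sum_list_map comp_def)
  \<comment> \<open>The mirror image, obtained by negating both functions.\<close>
  have nonneg: "d' E = d' B / d B * d E" if "E \<in> D" "d E \<ge> 0" for E
  proof -
    have "- (- d' E) / - d' B \<le> - (- d E) / - d B"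
      using proportional_if_same_signs_aux[of D "\<lambda>A. - d A" "\<lambda>A. - d' A" B E] neg B that
      by (simp add: uminus)
    moreover have "- (- d E) / - d B \<le> - (- d' E) / - d' B"
      using proportional_if_same_signs_aux[of D "\<lambda>A. - d' A" "\<lambda>A. - d A" B E] neg B d'B that sgn[OF that(1)]
      by (simp add: uminus not_less[symmetric])
    ultimately have "d E / d B = d' E / d' B" by simp
    then show ?thesis using B d'B by (simp add: field_simps)
  qed
  have "d' A / d A = d' B / d B" using nonpos[of B] B by simp
  then have "d' E = d' A / d A * d E" if "E \<in> D" for E
    using nonpos[OF that] nonneg[OF that] by (metis linorder_linear)
  moreover have "0 < d' A / d A" using A d'A by simp
  ultimately show ?thesis using that by blast
qed

section \<open>Adjacent transpositions and test ballots of two candidates\<close>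

lemma adjacent_swaps_connect:
  assumes swap: "\<And>U x y V. \<phi> (U @ x # y # V) \<Longrightarrow> \<phi> (U @ y # x # V)"
    and "\<phi> (U @ xs)" "distinct xs" "distinct ys" "set xs = set ys"
  shows "\<phi> (U @ ys)"
  using assms(2-)
proof (induction ys arbitrary: U xs)
  case (Cons y ys)
  obtain p q where xs: "xs = p @ y # q" using Cons.prems by (metis list.set_intros(1) split_list)
  \<comment> \<open>Adjacent swaps carry the first letter of the target to the front, where it joins
    the fixed prefix \<open>U\<close>.\<close>
  have "\<phi> (U @ p @ y # q) \<Longrightarrow> \<phi> (U @ y # p @ q)" for p q
  proof (induction p arbitrary: q rule: rev_induct)
    case (snoc z p)
    then show ?case using swap[of "U @ p" z y q] by simp
  qed auto
  then have "\<phi> ((U @ [y]) @ (p @ q))" using Cons.prems xs by simp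
  moreover have "set (p @ q) = set ys" using Cons.prems xs by auto
  ultimately show ?case using Cons.IH[of "U @ [y]" "p @ q"] Cons.prems xs by auto
qed auto

corollary adjacent_swaps_connect_axes:
  assumes "\<And>U x y V. \<phi> (U @ x # y # V) \<Longrightarrow> \<phi> (U @ y # x # V)"
    and "is_axis C ax" "is_axis C ax'" "\<phi> ax"
  shows "\<phi> ax'"
  using adjacent_swaps_connect[of \<phi> "[]" ax ax'] assms by (simp add: is_axis_def)

lemma is_interval_adjacent_pair:
  assumes "distinct (U @ p # q # V)"
  shows "is_interval {p, q} (U @ p # q # V)"
proof -
  have "holes (word {p, q} (U @ p # q # V)) = 0"
    using assms
  proof (induction U)
    case Nil
    have "word {p, q} V = replicate (length V) False"
      using Nil by (auto simp: word_def intro!: nth_equalityI)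
    moreover have "holes (True # True # replicate n False) = 0" for n
      by (cases n) (auto, induct_tac nat, auto)
    ultimately show ?case by simp
  qed auto
  then show ?thesis using is_interval_iff_holes[OF assms] by simp
qed

lemma not_is_interval_separated_pair:
  assumes "distinct (U @ p # r # q # V)"
  shows "\<not> is_interval {p, q} (U @ p # r # q # V)"
proof -
  have "before (U @ p # r # q # V) p r" using before_append_Cons'[of r "r # q # V" U p] by simp
  moreover have "before (U @ p # r # q # V) r q"
    using before_append_Cons'[of q "q # V" "U @ [p]" r] by simp
  ultimately show ?thesis using assms unfolding is_interval_def by auto
qed

text \<open>An entry is determined by the prefix sets on either side of it, so omitting the cut
  between \<open>x\<close> and \<open>y\<close> frees exactly these two positions.\<close>

lemma swap_if_take_eq:
  assumes "is_axis C ax" "is_axis C (U @ x # y # V)"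
    and "\<And>i. 0 < i \<Longrightarrow> i < card C \<Longrightarrow> i \<noteq> Suc (length U) \<Longrightarrow>
      set (take i ax) = set (take i (U @ x # y # V))"
  shows "ax = U @ x # y # V \<or> ax = U @ y # x # V"
proof -
  let ?Y = "U @ x # y # V"
  have len: "length ax = card C" "length ?Y = card C" using assms is_axis_length by blast+
  have d: "distinct ax" "distinct ?Y" "set ax = set ?Y" using assms by (auto simp: is_axis_def)
  have take: "set (take i ax) = set (take i ?Y)" if i: "i \<le> card C" "i \<noteq> Suc (length U)" for i
  proof -
    consider "i = 0" | "0 < i" "i < card C" | "i = card C" using i by linarith
    then show ?thesis
      by cases (use assms(3) i len d in \<open>auto simp: take_all simp del: take_append\<close>)
  qed
  have nth: "ax ! i = ?Y ! i" if "i < card C" "i \<noteq> length U" "i \<noteq> Suc (length U)" for i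
    using nth_eq_if_take_eq[OF d(1,2), of i] take[of i] take[of "Suc i"] that len by auto
  obtain p q where ax: "ax = U @ p # q # V"
  proof
    show "ax = U @ (ax ! length U) # (ax ! Suc (length U)) # V"
    proof (rule nth_equalityI)
      fix i assume "i < length ax"
      then show "ax ! i = (U @ (ax ! length U) # (ax ! Suc (length U)) # V) ! i"
        using nth[of i] len
        by (cases "i = length U"; cases "i = Suc (length U)")
          (auto simp: nth_append nth_Cons split: nat.splits)
    qed (use len in auto)
  qed
  have "{p, q} = set ax - (set U \<union> set V)" using ax d(1) by auto
  also have "\<dots> = {x, y}" unfolding d(3) using d(2) by auto
  finally show ?thesis using ax by (auto simp: doubleton_eq_iff)
qed

section \<open>Uniqueness of normalised costs\<close>

locale linear_scoring_rule =
  fixes f :: "'a axis_rule"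
  assumes infinite_UNIV: "infinite (UNIV :: 'a set)"
    and axis_rule: "is_axis_rule f"
    and scoring: "scoring_rule f"
    and neutral: "neutral f"
    and linearity: "consistent_with_linearity f"
    and cloning: "resistant_to_cloning f"
    and clearance: "inclusion_clearance f"
begin

lemma rule_nonempty: "finite C \<Longrightarrow> is_profile C P \<Longrightarrow> \<exists>ax. ax \<in> f C P"
  and rule_axis: "finite C \<Longrightarrow> is_profile C P \<Longrightarrow> ax \<in> f C P \<Longrightarrow> is_axis C ax"
  and rule_rev: "finite C \<Longrightarrow> is_profile C P \<Longrightarrow> ax \<in> f C P \<Longrightarrow> rev ax \<in> f C P"
  using axis_rule unfolding is_axis_rule_def axes_def by blast+

lemma rule_single_ballot:
  assumes "finite C" "A \<noteq> {}" "A \<subseteq> C"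
  shows "f C [A] = con C [A]" "con C [A] \<noteq> {}"
proof -
  obtain ax where "is_axis C ax" "is_interval A ax" using ex_is_interval_axis assms by metis
  then show "con C [A] \<noteq> {}" by (auto simp: con_def)
  then show "f C [A] = con C [A]"
    using linearity assms by (simp add: consistent_with_linearity_def linear_profile_def)
qed

text \<open>A constant subtracted per ballot shifts the totals of all axes alike. On the profile
  \<open>[A]\<close> the minimisers are, by linearity, the interval axes, so the shifted cost
  vanishes there and only there.\<close>

lemma ex_normal_cost:
  assumes "finite C"
  obtains c where "normal_cost f C c"
proof -
  obtain c where c: "induced_on f C c" using scoring assms unfolding scoring_rule_def by blast
  define best where "best A = (SOME ax. ax \<in> f C [A])" for A
  define c' where "c' A ax = c A ax - c A (best A)" for A ax
  have best: "best A \<in> f C [A]" if "A \<noteq> {}" "A \<subseteq> C" for A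
    using rule_single_ballot[OF assms that] unfolding best_def by (metis ex_in_conv someI_ex)
  have "total_cost c' P ax = total_cost c P ax - (\<Sum>A\<leftarrow>P. c A (best A))" for P ax
    by (induction P) (auto simp: c'_def)
  then have "induced_on f C c'"
    using c by (simp add: induced_on_def argmin_axes_def)
  moreover have "0 \<le> c' A ax \<and> (c' A ax = 0 \<longleftrightarrow> is_interval A ax)"
    if A: "A \<noteq> {}" "A \<subseteq> C" and ax: "is_axis C ax" for A ax
  proof -
    have mem: "ax \<in> f C [A] \<longleftrightarrow> is_axis C ax \<and> (\<forall>ax'. is_axis C ax' \<longrightarrow> c A ax \<le> c A ax')" for ax
      using c A by (simp add: induced_on_def argmin_axes_def)
    have le: "c A (best A) \<le> c A ax" using best[OF A] mem ax by blast
    have "ax \<in> f C [A] \<longleftrightarrow> c A ax = c A (best A)"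
      using best[OF A] mem[of "best A"] mem[of ax] ax by (metis order.antisym)
    moreover have "ax \<in> f C [A] \<longleftrightarrow> is_interval A ax"
      using rule_single_ballot[OF assms A] ax by (simp add: con_def)
    ultimately show ?thesis using le by (simp add: c'_def)
  qed
  ultimately show ?thesis using that unfolding normal_cost_def by blast
qed

text \<open>Turns a cost comparison into membership in \<open>f C Q\<close> with one
  \<open>Q\<close> for all normal costs, so that all of them must answer the comparison
  alike.\<close>

lemma swap_comparison:
  assumes "finite C" "3 \<le> card C" "is_profile C P"
    and Y: "is_axis C (U @ x # y # V)"
  obtains Q where "is_profile C Q"
    "\<And>c. normal_cost f C c \<Longrightarrow>
      total_cost c P (U @ x # y # V) \<le> total_cost c P (U @ y # x # V) \<longleftrightarrow> U @ x # y # V \<in> f C Q"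
proof -
  let ?Y = "U @ x # y # V" and ?Z = "U @ y # x # V"
  \<comment> \<open>All cuts of the axis except the one between \<open>x\<close> and
    \<open>y\<close>.\<close>
  define I where "I = filter (\<lambda>i. i \<noteq> Suc (length U)) [1..<card C]"
  define L where "L = cuts ?Y I"
  have Z: "is_axis C ?Z" using Y by (auto simp: is_axis_def)
  have len: "length ?Y = card C" using is_axis_length[OF Y] .
  have L: "is_profile C L" unfolding L_def
    using Y len by (intro is_profile_cuts) (auto simp: I_def is_axis_def)
  have conY: "?Y \<in> con C L" unfolding L_def using Y by (intro con_cutsI) auto
  have "set (take i ?Z) = set (take i ?Y)" if "i \<noteq> Suc (length U)" for i
  proof (cases "i \<le> length U")
    case False
    then have "i = length U + Suc (Suc (i - length U - 2))" using that by auto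
    then obtain j where "i = length U + Suc (Suc j)" by blast
    then show ?thesis by auto
  qed auto
  then have conZ: "?Z \<in> con C L" unfolding L_def using Y Z by (intro con_cutsI) (auto simp: I_def)
  obtain c0 where c0: "normal_cost f C c0" using ex_normal_cost assms(1) by blast
  obtain Q where Q: "set Q = set L" "f C (Q @ P) \<subseteq> con C L"
    using ex_forcing_profile[OF assms(1) c0 L _ assms(3)] conY by blast
  have prof: "is_profile C (Q @ P)" "is_profile C Q"
    using L Q(1) assms(3) is_profile_cong[of Q L] by auto
  obtain ax where ax: "ax \<in> f C (Q @ P)" using rule_nonempty[OF assms(1) prof(1)] by blast
  have YZ: "ax' = ?Y \<or> ax' = ?Z" if "is_axis C ax'" "\<forall>i \<in> set I. set (take i ax') = set (take i ?Y)" for ax'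
    using that(2) swap_if_take_eq[OF that(1) Y] by (auto simp: I_def)
  have "ax \<in> con C (cuts ?Y I)" using ax Q L_def by auto
  then have "(\<forall>i \<in> set I. set (take i ax) = set (take i ?Y)) \<or>
      (\<forall>i \<in> set I. set (take i (rev ax)) = set (take i ?Y))"
    using len by (intro con_cutsD[OF Y]) (auto simp: I_def)
  \<comment> \<open>The selected axis is one of the two or the reverse of one; closure under
    reversal brings it into the stated orientation.\<close>
  then have YZ': "?Y \<in> f C (Q @ P) \<or> ?Z \<in> f C (Q @ P)"
    using YZ[of ax] YZ[of "rev ax"] ax rule_rev[OF assms(1) prof(1) ax] rule_axis[OF assms(1) prof(1) ax]
    by auto
  have "total_cost c P ?Y \<le> total_cost c P ?Z \<longleftrightarrow> ?Y \<in> f C (Q @ P)" if c: "normal_cost f C c" for c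
  proof -
    have "total_cost c Q ?Y = 0" "total_cost c Q ?Z = 0"
      using total_cost_eq_0_iff[OF c prof(2)] Y Z conY conZ con_cong[OF Q(1)] by auto
    then show ?thesis
      using YZ' mem_rule_iff[OF c prof(1), of ?Y] mem_rule_iff[OF c prof(1), of ?Z] Y Z by fastforce
  qed
  then show ?thesis using that prof by blast
qed

lemma swap_proportional:
  assumes "finite C" "3 \<le> card C" and c: "normal_cost f C c" and c': "normal_cost f C c'"
    and Y: "is_axis C (U @ x # y # V)"
  obtains \<alpha> where "0 < \<alpha>" "\<And>A. A \<noteq> {} \<Longrightarrow> A \<subseteq> C \<Longrightarrow>
    c' A (U @ x # y # V) - c' A (U @ y # x # V) = \<alpha> * (c A (U @ x # y # V) - c A (U @ y # x # V))"
proof -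
  let ?Y = "U @ x # y # V" and ?Z = "U @ y # x # V"
  have Z: "is_axis C ?Z" using Y by (auto simp: is_axis_def)
  define D where "D = {A. A \<noteq> {} \<and> A \<subseteq> C}"
  define d where "d c A = c A ?Y - c A ?Z" for c :: "'a set \<Rightarrow> 'a list \<Rightarrow> real" and A
  have sum: "(\<Sum>A\<leftarrow>P. d c A) = total_cost c P ?Y - total_cost c P ?Z" for P c
    by (induction P) (auto simp: d_def)
  have pos: "0 < (\<Sum>A\<leftarrow>P. d c A) \<longleftrightarrow> 0 < (\<Sum>A\<leftarrow>P. d c' A)" if "set P \<subseteq> D" for P
  proof -
    have P: "is_profile C P" using that by (auto simp: D_def is_profile_def)
    obtain Q where "\<And>c. normal_cost f C c \<Longrightarrow> total_cost c P ?Y \<le> total_cost c P ?Z \<longleftrightarrow> ?Y \<in> f C Q"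
      using swap_comparison[OF assms(1,2) P Y] by metis
    then have "total_cost c P ?Y \<le> total_cost c P ?Z \<longleftrightarrow> total_cost c' P ?Y \<le> total_cost c' P ?Z"
      using c c' by blast
    then show ?thesis unfolding sum by linarith
  qed
  have neg: "(\<Sum>A\<leftarrow>P. d c A) < 0 \<longleftrightarrow> (\<Sum>A\<leftarrow>P. d c' A) < 0" if "set P \<subseteq> D" for P
  proof -
    have P: "is_profile C P" using that by (auto simp: D_def is_profile_def)
    obtain Q where "\<And>c. normal_cost f C c \<Longrightarrow> total_cost c P ?Z \<le> total_cost c P ?Y \<longleftrightarrow> ?Z \<in> f C Q"
      using swap_comparison[OF assms(1,2) P Z] by metis
    then have "total_cost c P ?Z \<le> total_cost c P ?Y \<longleftrightarrow> total_cost c' P ?Z \<le> total_cost c' P ?Y"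
      using c c' by blast
    then show ?thesis unfolding sum by linarith
  qed
  have dist: "distinct ?Y" "set ?Y = C" using Y by (auto simp: is_axis_def)
  have cost: "0 < c A ax" if "A \<in> D" "is_axis C ax" "\<not> is_interval A ax" for A ax
    using normal_costD[OF c, of A ax] that by (auto simp: D_def less_le)
  have cost0: "c A ax = 0" if "A \<in> D" "is_axis C ax" "is_interval A ax" for A ax
    using normal_costD[OF c, of A ax] that by (auto simp: D_def)
  \<comment> \<open>A neighbour \<open>v\<close> of the swapped pair supplies both signs: under the
    swap one of \<open>{x, v}\<close>, \<open>{y, v}\<close> becomes adjacent while the other is
    separated. This is where a third candidate is required.\<close>
  have "\<exists>A B. A \<in> D \<and> B \<in> D \<and> 0 < d c A \<and> d c B < 0"
  proof (cases V)
    case (Cons v W)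
    have "{x, v} \<in> D" "{y, v} \<in> D" using dist Cons by (auto simp: D_def)
    moreover have "0 < c {x, v} ?Y" "0 < c {y, v} ?Z"
      using cost calculation Y Z not_is_interval_separated_pair[of U x y v W]
        not_is_interval_separated_pair[of U y x v W] dist Cons by auto
    moreover have "c {y, v} ?Y = 0" "c {x, v} ?Z = 0"
      using cost0 calculation Y Z is_interval_adjacent_pair[of "U @ [x]" y v W]
        is_interval_adjacent_pair[of "U @ [y]" x v W] dist Cons by auto
    ultimately show ?thesis by (intro exI[of _ "{x, v}"] exI[of _ "{y, v}"]) (auto simp: d_def)
  next
    case Nil
    have "length ?Y \<ge> 3" using is_axis_length[OF Y] assms by simp
    then have "U \<noteq> []" using Nil by auto
    then obtain W v where U: "U = W @ [v]" by (metis rev_exhaust)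
    have "{v, x} \<in> D" "{v, y} \<in> D" using dist U by (auto simp: D_def)
    moreover have "0 < c {v, y} ?Y" "0 < c {v, x} ?Z"
      using cost calculation Y Z not_is_interval_separated_pair[of W v x y V]
        not_is_interval_separated_pair[of W v y x V] dist U by auto
    moreover have "c {v, x} ?Y = 0" "c {v, y} ?Z = 0"
      using cost0 calculation Y Z is_interval_adjacent_pair[of W v x "y # V"]
        is_interval_adjacent_pair[of W v y "x # V"] dist U by auto
    ultimately show ?thesis by (intro exI[of _ "{v, y}"] exI[of _ "{v, x}"]) (auto simp: d_def)
  qed
  then obtain A B where "A \<in> D" "0 < d c A" "B \<in> D" "d c B < 0" by blast
  then obtain \<alpha> where "0 < \<alpha>" "\<And>E. E \<in> D \<Longrightarrow> d c' E = \<alpha> * d c E"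
    using proportional_if_same_signs[of D "d c" "d c'" A B] pos neg by blast
  then show ?thesis using that by (simp add: D_def d_def)
qed

text \<open>On three consecutive candidates \<open>x y z\<close>, the ballot \<open>{x, z}\<close> becomes an interval after
  swapping \<open>x y\<close> and also after swapping \<open>y z\<close>; this makes the proportionality factors of
  neighbouring swaps agree.\<close>

lemma normal_cost_unique:
  assumes "finite C" "3 \<le> card C" and c: "normal_cost f C c" and c': "normal_cost f C c'"
  obtains \<alpha> where "0 < \<alpha>"
    "\<And>A ax. A \<noteq> {} \<Longrightarrow> A \<subseteq> C \<Longrightarrow> is_axis C ax \<Longrightarrow> c' A ax = \<alpha> * c A ax"
proof -
  define S where "S \<alpha> Y Z \<longleftrightarrow> (\<forall>A. A \<noteq> {} \<longrightarrow> A \<subseteq> C \<longrightarrow> c' A Y - c' A Z = \<alpha> * (c A Y - c A Z))" for \<alpha> Y Z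
  have SD: "c' A Y - c' A Z = \<alpha> * (c A Y - c A Z)"
    if "S \<alpha> Y Z" "A \<noteq> {}" "A \<subseteq> C" for \<alpha> Y Z A
    using that unfolding S_def by simp
  have sym: "S \<alpha> Z Y" if "S \<alpha> Y Z" for \<alpha> Y Z
    using that unfolding S_def by (simp add: algebra_simps)
  have ex: "\<exists>\<alpha>>0. S \<alpha> (U @ x # y # V) (U @ y # x # V)" if "is_axis C (U @ x # y # V)" for U x y V
    by (rule swap_proportional[OF assms that], rule exI, rule conjI, assumption) (simp add: S_def)
  have link: "\<alpha> = \<beta>" if ax: "is_axis C (U @ x # y # z # V)"
    and \<alpha>: "S \<alpha> (U @ x # y # z # V) (U @ y # x # z # V)"
    and \<beta>: "S \<beta> (U @ x # y # z # V) (U @ x # z # y # V)" for \<alpha> \<beta> U x y z V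
  proof -
    have d: "distinct (U @ x # y # z # V)" "{x, z} \<noteq> {}" "{x, z} \<subseteq> C"
      using ax by (auto simp: is_axis_def)
    have ax': "is_axis C (U @ y # x # z # V)" "is_axis C (U @ x # z # y # V)"
      using ax by (auto simp: is_axis_def)
    have "is_interval {x, z} (U @ y # x # z # V)" "is_interval {x, z} (U @ x # z # y # V)"
      using is_interval_adjacent_pair[of "U @ [y]" x z V] is_interval_adjacent_pair[of U x z "y # V"] d
      by auto
    then have "c {x, z} (U @ y # x # z # V) = 0" "c {x, z} (U @ x # z # y # V) = 0"
      "c' {x, z} (U @ y # x # z # V) = 0" "c' {x, z} (U @ x # z # y # V) = 0"
      using normal_costD(2)[OF c d(2,3)] normal_costD(2)[OF c' d(2,3)] ax' by simp_all
    moreover have "c {x, z} (U @ x # y # z # V) \<noteq> 0"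
      using normal_costD(2)[OF c d(2,3) ax] not_is_interval_separated_pair[OF d(1)] by simp
    moreover have "c' {x, z} (U @ x # y # z # V) - c' {x, z} (U @ y # x # z # V) =
        \<alpha> * (c {x, z} (U @ x # y # z # V) - c {x, z} (U @ y # x # z # V))"
      using SD[OF \<alpha> d(2,3)] .
    moreover have "c' {x, z} (U @ x # y # z # V) - c' {x, z} (U @ x # z # y # V) =
        \<beta> * (c {x, z} (U @ x # y # z # V) - c {x, z} (U @ x # z # y # V))"
      using SD[OF \<beta> d(2,3)] .
    ultimately show ?thesis by simp
  qed
  \<comment> \<open>Positions without a right neighbour satisfy \<open>T\<close> vacuously, so
    quantifying over all \<open>j\<close> is harmless; the bounds in \<open>down\<close> and
    \<open>all\<close> prevent starting from a vacuous instance.\<close>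
  define T where "T \<alpha> ax i \<longleftrightarrow> (\<forall>U x y V. ax = U @ x # y # V \<longrightarrow> length U = i \<longrightarrow>
    S \<alpha> ax (U @ y # x # V))" for \<alpha> ax i
  have up: "T \<alpha> ax (Suc i)" if ax: "is_axis C ax" and "T \<alpha> ax i" for \<alpha> ax i
    unfolding T_def
  proof (intro allI impI)
    fix U x y V assume ax': "ax = U @ x # y # V" and "length U = Suc i"
    then obtain W u where U: "U = W @ [u]" "length W = i" by (metis length_Suc_conv_rev)
    then have 1: "S \<alpha> (W @ u # x # y # V) (W @ x # u # y # V)"
      using that ax' unfolding T_def by auto
    obtain \<beta> where "S \<beta> (W @ u # x # y # V) (W @ u # y # x # V)"
      using ex[of "W @ [u]" x y V] ax ax' U by auto
    then show "S \<alpha> ax (U @ y # x # V)" using link[OF _ 1] ax ax' U by auto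
  qed
  have down: "T \<alpha> ax i" if ax: "is_axis C ax" and "T \<alpha> ax (Suc i)" "Suc (Suc i) < length ax" for \<alpha> ax i
    unfolding T_def
  proof (intro allI impI)
    fix U x y V assume ax': "ax = U @ x # y # V" and len: "length U = i"
    with that(3) obtain v W where V: "V = v # W" by (cases V) auto
    have "ax = (U @ [x]) @ y # v # W" using ax' V by simp
    then have 1: "S \<alpha> ((U @ [x]) @ y # v # W) ((U @ [x]) @ v # y # W)"
      using that(2) len unfolding T_def by (metis length_append_singleton)
    obtain \<beta> where "S \<beta> (U @ x # y # v # W) (U @ y # x # v # W)"
      using ex[of U x y "v # W"] ax ax' V by auto
    then show "S \<alpha> ax (U @ y # x # V)" using link[of U x y v W \<beta> \<alpha>] 1 ax ax' V by auto
  qed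
  have all: "T \<alpha> ax j" if ax: "is_axis C ax" and T: "T \<alpha> ax i" "Suc i < length ax" for \<alpha> ax i j
  proof -
    have "T \<alpha> ax 0"
      using T by (induction i) (auto intro: down[OF ax])
    then show ?thesis by (induction j) (auto intro: up[OF ax])
  qed
  have all': "\<forall>j. T \<alpha> ax j" if ax: "is_axis C ax" and "ax = U @ x # y # V" "S \<alpha> ax (U @ y # x # V)" for \<alpha> ax U x y V
  proof -
    have "T \<alpha> ax (length U)" using that unfolding T_def by (auto simp: append_eq_append_conv)
    moreover have "Suc (length U) < length ax" using that by simp
    ultimately show ?thesis using all[OF ax] by blast
  qed
  obtain ax0 where ax0: "is_axis C ax0"
    using assms(1) finite_distinct_list unfolding is_axis_def by metis
  then obtain x y V where xyV: "ax0 = [] @ x # y # V"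
    using is_axis_length[OF ax0] assms(2)
    by (metis One_nat_def append_Nil length_0_conv length_Suc_conv list.exhaust not_numeral_le_zero numeral_3_eq_3 Suc_le_eq Suc_le_mono list.size(3) not_less_zero)
  obtain \<alpha> where \<alpha>: "0 < \<alpha>" "\<forall>j. T \<alpha> ax0 j"
    using ex[of "[]" x y V] all'[OF ax0 xyV] ax0 xyV by auto
  define good where "good ax \<longleftrightarrow> is_axis C ax \<and> (\<forall>j. T \<alpha> ax j)" for ax
  \<comment> \<open>The swap leading from one axis to the next has the same factor when seen from
    the other axis, so one factor spreads over all axes.\<close>
  have swap: "good (U @ y # x # V)" if "good (U @ x # y # V)" for U x y V
  proof -
    have "is_axis C (U @ y # x # V)" using that unfolding good_def is_axis_def by auto
    moreover have "T \<alpha> (U @ x # y # V) (length U)" using that unfolding good_def by blast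
    then have "S \<alpha> (U @ x # y # V) (U @ y # x # V)" unfolding T_def by simp
    then have "S \<alpha> (U @ y # x # V) (U @ x # y # V)" by (rule sym)
    ultimately have "\<forall>j. T \<alpha> (U @ y # x # V) j" by (rule all'[OF _ refl])
    then show ?thesis using \<open>is_axis C (U @ y # x # V)\<close> unfolding good_def by blast
  qed
  have "good ax0" using ax0 \<alpha>(2) unfolding good_def by blast
  then have good: "good ax" if "is_axis C ax" for ax
    using adjacent_swaps_connect_axes[of good, OF swap ax0 that] by blast
  have "c' A ax = \<alpha> * c A ax" if A: "A \<noteq> {}" "A \<subseteq> C" and ax: "is_axis C ax" for A ax
  proof -
    \<comment> \<open>Differences determine the costs once one value is known: on an axis that keeps
      \<open>A\<close> together both costs are 0.\<close>
    obtain ax1 where ax1: "is_axis C ax1" "is_interval A ax1"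
      using ex_is_interval_axis[OF assms(1) A(2)] by blast
    define \<psi> where "\<psi> ax \<longleftrightarrow> is_axis C ax \<and> c' A ax = \<alpha> * c A ax" for ax
    have swap: "\<psi> (U @ y # x # V)" if "\<psi> (U @ x # y # V)" for U x y V
    proof -
      have "T \<alpha> (U @ x # y # V) (length U)"
        using good[of "U @ x # y # V"] that by (simp add: good_def \<psi>_def)
      then have "S \<alpha> (U @ x # y # V) (U @ y # x # V)" unfolding T_def by simp
      from SD[OF this A] show ?thesis using that by (auto simp: \<psi>_def algebra_simps is_axis_def)
    qed
    have "\<psi> ax1"
      using normal_costD(2)[OF c A ax1(1)] normal_costD(2)[OF c' A ax1(1)] ax1 by (simp add: \<psi>_def)
    from adjacent_swaps_connect_axes[of \<psi>, OF swap ax1(1) ax this] show ?thesis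
      by (simp add: \<psi>_def)
  qed
  then show ?thesis using that \<alpha> by blast
qed

end

section \<open>Costs as functions of words\<close>

lemma normal_cost_cong:
  assumes "normal_cost f C c"
    and "\<And>A ax. A \<noteq> {} \<Longrightarrow> A \<subseteq> C \<Longrightarrow> is_axis C ax \<Longrightarrow> c' A ax = c A ax"
  shows "normal_cost f C c'"
proof -
  have "total_cost c' P ax = total_cost c P ax" if "is_profile C P" "is_axis C ax" for P ax
    using that(1) by (induction P) (auto simp: assms(2) that(2))
  then have "argmin_axes c' C P = argmin_axes c C P" if "is_profile C P" for P
    using that unfolding argmin_axes_def by auto
  then show ?thesis using assms unfolding normal_cost_def induced_on_def by simp
qed

lemma normal_cost_divide:
  assumes "normal_cost f C c" "0 < (k :: real)"
  shows "normal_cost f C (\<lambda>A ax. c A ax / k)"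
proof -
  have "total_cost (\<lambda>A ax. c A ax / k) P ax = total_cost c P ax / k" for P ax
    by (induction P) (auto simp: add_divide_distrib)
  then have "argmin_axes (\<lambda>A ax. c A ax / k) C P = argmin_axes c C P" for P
    using assms(2) by (simp add: argmin_axes_def divide_le_cancel)
  then show ?thesis using assms unfolding normal_cost_def induced_on_def by simp
qed

lemma ex_bij_map:
  assumes "distinct xs" "distinct ys" "length xs = length ys"
  obtains \<sigma> where "map \<sigma> xs = ys" "bij_betw \<sigma> (set xs) (set ys)"
proof -
  let ?\<sigma> = "\<lambda>x. the (map_of (zip xs ys) x)"
  have "map ?\<sigma> xs = ys"
    using assms by (auto intro!: nth_equalityI simp: map_of_zip_nth)
  moreover from this have "bij_betw ?\<sigma> (set xs) (set ys)"
    using assms by (metis bij_betw_def distinct_map set_map)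
  ultimately show ?thesis using that by blast
qed

lemma word_map:
  assumes "inj_on \<sigma> C" "A \<subseteq> C" "set ax \<subseteq> C"
  shows "word (\<sigma> ` A) (map \<sigma> ax) = word A ax"
  using assms by (auto simp: word_def inj_on_image_mem_iff subset_iff)

lemma bij_betw_map_axes:
  assumes "bij_betw \<sigma> C C'"
  shows "bij_betw (map \<sigma>) (axes C) (axes C')"
proof -
  have inj: "inj_on \<sigma> C" "\<sigma> ` C = C'" using assms by (auto simp: bij_betw_def)
  have "inj_on (map \<sigma>) (axes C)"
  proof (rule inj_onI)
    fix xs ys assume "xs \<in> axes C" "ys \<in> axes C" "map \<sigma> xs = map \<sigma> ys"
    then show "xs = ys" using inj map_inj_on[of \<sigma> xs ys] by (auto simp: axes_def is_axis_def)
  qed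
  moreover have "ys \<in> map \<sigma> ` axes C" if "ys \<in> axes C'" for ys
  proof -
    let ?xs = "map (inv_into C \<sigma>) ys"
    have *: "\<sigma> (inv_into C \<sigma> y) = y" if "y \<in> set ys" for y
      using \<open>ys \<in> axes C'\<close> inj that f_inv_into_f[of y \<sigma> C] by (auto simp: axes_def is_axis_def)
    then have "map \<sigma> ?xs = ys" by (simp add: map_idI)
    moreover have "distinct ?xs" using * \<open>ys \<in> axes C'\<close> calculation
      by (metis (no_types, lifting) axes_def distinct_map is_axis_def mem_Collect_eq)
    moreover have "set ?xs = C"
      using \<open>ys \<in> axes C'\<close> assms bij_betw_inv_into[OF assms]
      by (auto simp: axes_def is_axis_def bij_betw_def)
    ultimately show ?thesis unfolding axes_def is_axis_def by (metis (mono_tags) image_eqI mem_Collect_eq)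
  qed
  moreover have "map \<sigma> xs \<in> axes C'" if "xs \<in> axes C" for xs
    using that inj by (auto simp: axes_def is_axis_def distinct_map)
  ultimately show ?thesis by (auto simp: bij_betw_def)
qed

context linear_scoring_rule
begin

text \<open>By neutrality renaming candidates turns the rule on \<open>C\<close> into the rule on
  \<open>C'\<close>; words, and with them intervals, are unchanged, so a normal cost can be pulled
  back.\<close>

lemma normal_cost_transport:
  assumes "finite C" "bij_betw \<sigma> C C'" "normal_cost f C' c"
  shows "normal_cost f C (\<lambda>A ax. c (\<sigma> ` A) (map \<sigma> ax))"
proof -
  have inj: "inj_on \<sigma> C" "\<sigma> ` C = C'" using assms by (auto simp: bij_betw_def)
  note bij = bij_betw_map_axes[OF assms(2)]
  have ax': "is_axis C' (map \<sigma> ax)" if "is_axis C ax" for ax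
    using bij_betw_apply[OF bij, of ax] that by (simp add: axes_def)
  have "0 \<le> c (\<sigma> ` A) (map \<sigma> ax) \<and> (c (\<sigma> ` A) (map \<sigma> ax) = 0 \<longleftrightarrow> is_interval A ax)"
    if A: "A \<noteq> {}" "A \<subseteq> C" and ax: "is_axis C ax" for A ax
  proof -
    have "is_interval (\<sigma> ` A) (map \<sigma> ax) \<longleftrightarrow> is_interval A ax"
      using is_interval_iff_holes[of ax A] is_interval_iff_holes[of "map \<sigma> ax" "\<sigma> ` A"]
        word_map[OF inj(1) A(2), of ax] ax ax'[OF ax] by (auto simp: is_axis_def)
    then show ?thesis
      using normal_costD[OF assms(3), of "\<sigma> ` A" "map \<sigma> ax"] A inj ax'[OF ax] by auto
  qed
  moreover have "f C P = argmin_axes (\<lambda>A ax. c (\<sigma> ` A) (map \<sigma> ax)) C P" if P: "is_profile C P" for P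
  proof -
    let ?P = "map ((`) \<sigma>) P"
    have P': "is_profile C' ?P" using P inj by (force simp: is_profile_def)
    have f': "f C' ?P = map \<sigma> ` f C P"
      using neutral assms(1,2) P unfolding neutral_def by blast
    have tot: "total_cost (\<lambda>A ax. c (\<sigma> ` A) (map \<sigma> ax)) P ax = total_cost c ?P (map \<sigma> ax)" for ax
      by (induction P) auto
    have "ax \<in> f C P \<longleftrightarrow> is_axis C ax \<and> map \<sigma> ax \<in> f C' ?P" for ax
    proof
      assume "is_axis C ax \<and> map \<sigma> ax \<in> f C' ?P"
      then obtain ay where "ay \<in> f C P" "map \<sigma> ax = map \<sigma> ay" "is_axis C ax" using f' by auto
      moreover have "is_axis C ay" using rule_axis[OF assms(1) P] calculation(1) .
      ultimately show "ax \<in> f C P"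
        using inj_onD[OF bij_betw_imp_inj_on[OF bij], of ax ay] by (simp add: axes_def)
    qed (use f' rule_axis[OF assms(1) P] in auto)
    moreover have "(\<forall>ax'. is_axis C' ax' \<longrightarrow> t \<le> total_cost c ?P ax') \<longleftrightarrow>
        (\<forall>ax. is_axis C ax \<longrightarrow> t \<le> total_cost c ?P (map \<sigma> ax))" for t
    proof -
      have "{ax'. is_axis C' ax'} = map \<sigma> ` {ax. is_axis C ax}"
        using bij unfolding bij_betw_def axes_def by simp
      then show ?thesis by (metis (mono_tags, lifting) ax' image_iff mem_Collect_eq)
    qed
    ultimately show ?thesis
      using mem_rule_iff[OF assms(3) P'] ax' by (auto simp: argmin_axes_def tot)
  qed
  ultimately show ?thesis unfolding normal_cost_def induced_on_def by blast
qed

text \<open>Both transported costs are proportional by uniqueness; summing the costs of the ballots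
  \<open>{ax ! 0, ax ! 2}\<close> over all axes \<open>ax\<close> shows that the factor is 1.\<close>

lemma normal_cost_transport_eq:
  fixes C :: "'a set"
  assumes "finite C" "3 \<le> card C" "bij_betw \<sigma> C C'" "bij_betw \<pi> C C'" "normal_cost f C' c"
    and "A \<noteq> {}" "A \<subseteq> C" "is_axis C ax"
  shows "c (\<pi> ` A) (map \<pi> ax) = c (\<sigma> ` A) (map \<sigma> ax)"
proof -
  define B :: "'a list \<Rightarrow> 'a set" where "B ax = {ax ! 0, ax ! 2}" for ax
  obtain \<alpha> where \<alpha>: "\<And>A ax. A \<noteq> {} \<Longrightarrow> A \<subseteq> C \<Longrightarrow> is_axis C ax \<Longrightarrow>
      c (\<pi> ` A) (map \<pi> ax) = \<alpha> * c (\<sigma> ` A) (map \<sigma> ax)"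
    using normal_cost_unique[OF assms(1,2) normal_cost_transport[OF assms(1,3,5)]
        normal_cost_transport[OF assms(1,4,5)]] by metis
  have card: "finite C'" "card C' = card C"
    using assms(1,3) bij_betw_finite bij_betw_same_card by metis+
  have B: "B ax \<noteq> {}" "B ax \<subseteq> D" if "is_axis D ax" "3 \<le> card D" for ax and D :: "'a set"
    using that is_axis_length[OF that(1)] nth_mem[of 0 ax] nth_mem[of 2 ax]
    by (auto simp: B_def is_axis_def)
  have Bmap: "\<rho> ` B ax = B (map \<rho> ax)" if "is_axis C ax" for \<rho> ax
    using is_axis_length[OF that] assms(2) by (simp add: B_def)
  \<comment> \<open>Each bijection merely reindexes the sum over all axes on \<open>C'\<close>,
    because \<open>B\<close> picks its candidates by position.\<close>
  have sum: "(\<Sum>ax \<in> axes C. c (\<rho> ` B ax) (map \<rho> ax)) = (\<Sum>ax \<in> axes C'. c (B ax) ax)"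
    if "bij_betw \<rho> C C'" for \<rho>
    using sum.reindex_bij_betw[OF bij_betw_map_axes[OF that], of "\<lambda>ax. c (B ax) ax"]
    by (simp add: Bmap axes_def)
  have "0 < (\<Sum>ax \<in> axes C'. c (B ax) ax)"
  proof (rule sum_pos)
    show "finite (axes C')" using finite_axes[OF card(1)] by (simp add: axes_def)
    show "axes C' \<noteq> {}"
      using finite_distinct_list[OF card(1)] by (auto simp: axes_def is_axis_def)
    fix ax assume "ax \<in> axes C'"
    then have ax: "is_axis C' ax" "distinct ax" by (auto simp: axes_def is_axis_def)
    then have "3 \<le> length ax" using is_axis_length card assms(2) by metis
    then obtain x y z V where xyz: "ax = [] @ x # y # z # V"
      by (metis Suc_le_length_iff append_Nil numeral_3_eq_3)
    then have "\<not> is_interval (B ax) ax"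
      using not_is_interval_separated_pair[of "[]" x y z V] ax by (simp add: B_def)
    then show "0 < c (B ax) ax"
      using normal_costD[OF assms(5) B[OF ax(1)] ax(1)] card assms(2) by auto
  qed
  moreover have "(\<Sum>ax \<in> axes C. c (\<pi> ` B ax) (map \<pi> ax)) =
      \<alpha> * (\<Sum>ax \<in> axes C. c (\<sigma> ` B ax) (map \<sigma> ax))"
    unfolding sum_distrib_left using \<alpha> B assms(2) by (intro sum.cong) (auto simp: axes_def)
  ultimately have "\<alpha> = 1" using sum[OF assms(3)] sum[OF assms(4)] by simp
  then show ?thesis using \<alpha>[OF assms(6-8)] by simp
qed

lemma ex_word_cost:
  assumes "3 \<le> m"
  obtains g where "\<And>C. finite C \<Longrightarrow> card C = m \<Longrightarrow> normal_cost f C (\<lambda>A ax. g (word A ax))"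
proof -
  obtain C0 :: "'a set" where C0: "finite C0" "card C0 = m"
    using infinite_arbitrarily_large[OF infinite_UNIV] by blast
  obtain c where c: "normal_cost f C0 c" using ex_normal_cost C0 by blast
  obtain ax0 where ax0: "is_axis C0 ax0"
    using C0 finite_distinct_list unfolding is_axis_def by metis
  \<comment> \<open>A word is decoded into a ballot on one reference axis of one reference set of
    size \<open>m\<close>.\<close>
  define g where "g w = c {ax0 ! i | i. i < m \<and> w ! i} ax0" for w
  have "normal_cost f C (\<lambda>A ax. g (word A ax))" if C: "finite C" "card C = m" for C
  proof -
    obtain \<pi> where \<pi>: "bij_betw \<pi> C C0"
      using C C0 by (metis finite_same_card_bij)
    show ?thesis
    proof (rule normal_cost_cong[OF normal_cost_transport[OF C(1) \<pi> c]])
      fix A ax assume A: "A \<noteq> {}" "A \<subseteq> C" and ax: "is_axis C ax"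
      have len: "length ax = m" "length ax0 = m" using is_axis_length ax ax0 C C0 by metis+
      \<comment> \<open>\<open>\<sigma>\<close> varies with \<open>ax\<close>, whereas the cost on
        \<open>C\<close> is transported along the fixed \<open>\<pi>\<close>; independence of the
        bijection bridges the two.\<close>
      obtain \<sigma> where \<sigma>: "map \<sigma> ax = ax0" "bij_betw \<sigma> C C0"
        using ex_bij_map[of ax ax0] ax ax0 len unfolding is_axis_def by metis
      have "A = {ax ! i | i. i < m \<and> word A ax ! i}"
        using A ax len by (fastforce simp: word_def is_axis_def in_set_conv_nth)
      then have "\<sigma> ` A = \<sigma> ` {ax ! i | i. i < m \<and> word A ax ! i}" by simp
      also have "\<dots> = {\<sigma> (ax ! i) | i. i < m \<and> word A ax ! i}" by auto
      also have "\<dots> = {ax0 ! i | i. i < m \<and> word A ax ! i}"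
        using \<sigma>(1) len by (metis (no_types, lifting) nth_map)
      finally show "g (word A ax) = c (\<pi> ` A) (map \<pi> ax)"
        using normal_cost_transport_eq[OF C(1) _ \<sigma>(2) \<pi> c A ax] C assms \<sigma> by (simp add: g_def)
    qed
  qed
  then show ?thesis using that by blast
qed

end

section \<open>Cloning\<close>

lemma holes_duplicate: "holes (u @ b # b # v) = holes (u @ b # v)"
proof (induction u)
  case (Cons x u)
  then show ?case by (cases u) auto
qed (cases b; simp)

lemma is_interval_singleton: "distinct ax \<Longrightarrow> is_interval {x} ax"
  by (auto simp: is_interval_iff_nth nth_eq_iff_index_eq)

lemma adjacent_if_is_interval_pair:
  assumes "distinct ax" "a \<in> set ax" "b \<in> set ax" "a \<noteq> b" "is_interval {a, b} ax"
  obtains u v where "ax = u @ a # b # v" | u v where "ax = u @ b # a # v"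
proof -
  have adj: "\<exists>u v. ax = u @ p # q # v" if "ax = u @ p # s @ q # v" "{p, q} = {a, b}" for u p s q v
  proof (cases s)
    case (Cons x s')
    have "before ax p x" using before_append_Cons'[of x "s @ q # v" u p] Cons that by simp
    moreover have "before ax x q" using before_append_Cons'[of q "s' @ q # v" "u @ [p]" x] Cons that by simp
    ultimately have "x \<in> {a, b}" using assms(5) that(2) unfolding is_interval_def by blast
    then have "x \<in> {p, q}" using that(2) by simp
    then show ?thesis using assms(1) that(1) Cons by auto
  qed (use that in auto)
  obtain u w where ax: "ax = u @ a # w" using assms(2) by (meson split_list)
  with assms have "b \<in> set u \<or> b \<in> set w" by auto
  then show ?thesis
  proof
    assume "b \<in> set w"
    then obtain s v where "w = s @ b # v" by (meson split_list)
    then show ?thesis using adj[of u a s b v] ax that(1) by auto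
  next
    assume "b \<in> set u"
    then obtain s v where "u = v @ b # s" by (meson split_list)
    then show ?thesis using adj[of v b s a w] ax that(2) by (auto simp: insert_commute)
  qed
qed

lemma remove_cand_append [simp]: "remove_cand a (P @ Q) = remove_cand a P @ remove_cand a Q"
  by (simp add: remove_cand_def)

context linear_scoring_rule
begin

text \<open>Such ballots cost nothing on any axis. This disposes of the copies of
  \<open>{a'}\<close> that the pair ballots leave behind when \<open>a\<close> is removed.\<close>

lemma rule_append_intervals:
  assumes "finite C" "is_profile C P" "is_profile C Q" "\<And>ax. is_axis C ax \<Longrightarrow> ax \<in> con C Q"
  shows "f C (Q @ P) = f C P"
proof -
  obtain c where c: "normal_cost f C c" using ex_normal_cost assms(1) by blast
  have "total_cost c (Q @ P) ax = total_cost c P ax" if "is_axis C ax" for ax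
    using total_cost_eq_0_iff[OF c assms(3) that] assms(4)[OF that] by simp
  moreover have "is_profile C (Q @ P)" using assms by simp
  ultimately show ?thesis
    using mem_rule_iff[OF c] assms(2) by (metis (no_types, lifting) subsetI subset_antisym)
qed

text \<open>Forcing two clones \<open>a\<close>, \<open>a'\<close> to be adjacent by copies of the ballot \<open>{a, a'}\<close> turns the
  cost on \<open>insert a C\<close> of the duplicated axes into a cost on \<open>C\<close>, since that ballot becomes
  costless once \<open>a\<close> is removed.\<close>

lemma normal_cost_duplicate:
  assumes C: "finite C" "a' \<in> C" "a \<notin> C" and g: "normal_cost f (insert a C) (\<lambda>A ax. g (word A ax))"
  defines "clone \<equiv> \<lambda>A. if a' \<in> A then insert a A else A"
    and "dup \<equiv> \<lambda>ax. concat (map (\<lambda>x. if x = a' then [a', a] else [x]) ax)"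
  shows "normal_cost f C (\<lambda>A ax. g (word (clone A) (dup ax)))"
    and "\<And>u v A. A \<subseteq> C \<Longrightarrow> is_axis C (u @ a' # v) \<Longrightarrow>
      word (clone A) (dup (u @ a' # v)) = word A u @ (a' \<in> A) # (a' \<in> A) # word A v"
proof -
  let ?C = "insert a C"
  let ?c = "\<lambda>A ax. g (word A ax)" and ?c2 = "\<lambda>A ax. g (word (clone A) (dup ax))"
  have dup_notin: "dup u = u" if "a' \<notin> set u" for u
    using that unfolding dup_def by (induction u) auto
  have dup: "dup (u @ a' # v) = u @ a' # a # v" if "distinct (u @ a' # v)" for u v
    using that dup_notin[of u] dup_notin[of v] by (simp add: dup_def)
  have wclone: "word (clone A) u = word A u" if "a \<notin> set u" for A u
    using that by (intro word_cong) (auto simp: clone_def)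
  \<comment> \<open>Clones carry the same letter, so their order on the axis does not affect the
    word.\<close>
  have w1: "word (clone A) (u @ a' # a # v) = word A u @ (a' \<in> A) # (a' \<in> A) # word A v"
    and w2: "word (clone A) (u @ a # a' # v) = word A u @ (a' \<in> A) # (a' \<in> A) # word A v"
    if "a \<notin> set u" "a \<notin> set v" "a \<notin> A" for A u v
    using that C wclone[of u A] wclone[of v A] by (auto simp: clone_def)
  have split: "\<exists>u v. ax = u @ a' # v \<and> distinct (u @ a' # v) \<and> a \<notin> set u \<and> a \<notin> set v" if "is_axis C ax" for ax
    using that C split_list[of a' ax] by (force simp: is_axis_def)
  have dup_axis: "is_axis ?C (dup ax)" "restrict_axis a (dup ax) = ax" if ax: "is_axis C ax" for ax
  proof -
    obtain u v where uv: "ax = u @ a' # v" "distinct (u @ a' # v)" "a \<notin> set u" "a \<notin> set v"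
      using split[OF ax] by blast
    then show "is_axis ?C (dup ax)" "restrict_axis a (dup ax) = ax"
      using dup[of u v] ax C by (auto simp: is_axis_def restrict_axis_notin)
  qed
  have dup_word: "word (clone A) (dup (u @ a' # v)) = word A u @ (a' \<in> A) # (a' \<in> A) # word A v"
    if "A \<subseteq> C" "is_axis C (u @ a' # v)" for A u v
    using that C dup[of u v] w1[of u v A] by (auto simp: is_axis_def)
  have clone: "clone A \<noteq> {}" "clone A \<subseteq> ?C" "clone A - {a} = A" if "A \<noteq> {}" "A \<subseteq> C" for A
    using that C by (auto simp: clone_def)
  have "0 \<le> ?c2 A ax \<and> (?c2 A ax = 0 \<longleftrightarrow> is_interval A ax)"
    if A: "A \<noteq> {}" "A \<subseteq> C" and ax: "is_axis C ax" for A ax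
  proof -
    obtain u v where uv: "ax = u @ a' # v" using split[OF ax] by blast
    have "holes (word (clone A) (dup ax)) = holes (word A ax)"
      using dup_word[of A u v] A ax uv holes_duplicate by simp
    then have "is_interval (clone A) (dup ax) \<longleftrightarrow> is_interval A ax"
      using is_interval_iff_holes[of ax A] is_interval_iff_holes[of "dup ax" "clone A"]
        ax dup_axis(1)[OF ax] by (simp add: is_axis_def)
    then show ?thesis
      using normal_costD[OF g clone(1,2)[OF A] dup_axis(1)[OF ax]] by simp
  qed
  moreover have "f C P = argmin_axes ?c2 C P" if P: "is_profile C P" for P
  proof -
    define P' where "P' = map clone P"
    have P': "is_profile ?C P'" using P clone(1,2) unfolding P'_def is_profile_def by auto
    have finC: "finite ?C" using C by simp
    have pair: "{a, a'} \<noteq> {}" "{a, a'} \<subseteq> ?C" using C by auto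
    have prof: "is_profile ?C [{a, a'}]" using pair by simp
    obtain Q where Q: "set Q = set [{a, a'}]" "f ?C (Q @ P') \<subseteq> con ?C [{a, a'}]"
      using ex_forcing_profile[OF finC g prof rule_single_ballot(2)[OF finC pair] P'] by blast
    have Qprof: "is_profile ?C Q" using is_profile_cong[OF Q(1)] prof by simp
    have QP: "is_profile ?C (Q @ P')" using Qprof P' by simp
    have "remove_cand a P' = P"
      using P clone(3) unfolding P'_def remove_cand_def
      by (induction P) auto
    moreover have "set (remove_cand a Q) \<subseteq> {{a'}}"
      using Q(1) C by (auto simp: remove_cand_def)
    then have single: "A = {a'}" if "A \<in> set (remove_cand a Q)" for A using that by blast
    have "f C (remove_cand a Q @ P) = f C P"
      using C by (intro rule_append_intervals P)
        (auto simp: is_profile_def con_def is_axis_def is_interval_singleton dest!: single)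
    ultimately have rem: "f C (remove_cand a (Q @ P')) = f C P" by simp
    have "clones (Q @ P') a a'"
      using Q(1) P C by (auto simp: clones_def P'_def clone_def is_profile_def)
    moreover have "?C - {a} = C" using C by auto
    ultimately have fwd: "\<And>ax. ax \<in> f ?C (Q @ P') \<Longrightarrow> restrict_axis a ax \<in> f C P"
      and bwd: "\<And>ax'. ax' \<in> f C P \<Longrightarrow> \<exists>ax \<in> f ?C (Q @ P'). restrict_axis a ax = ax'"
      using cloning[unfolded resistant_to_cloning_def, rule_format, of ?C "Q @ P'" a a'] finC QP C rem
      by auto
    have tot_eq: "total_cost ?c P' ax = total_cost ?c2 P (restrict_axis a ax)"
      and Q0: "total_cost ?c Q ax = 0"
      if ax: "is_axis ?C ax" and int: "is_interval {a, a'} ax" for ax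
    proof -
      have "ax \<in> con ?C Q" using ax int Q(1) by (simp add: con_def)
      then show "total_cost ?c Q ax = 0" using total_cost_eq_0_iff[OF g Qprof ax] by simp
      have d: "distinct ax" "set ax = ?C" using ax by (auto simp: is_axis_def)
      obtain u v where uv: "ax = u @ a # a' # v \<or> ax = u @ a' # a # v"
        using adjacent_if_is_interval_pair[OF d(1) _ _ _ int] d C by (metis insertCI)
      then have r: "restrict_axis a ax = u @ a' # v" and nin: "a \<notin> set u" "a \<notin> set v"
        using d C by (auto simp: restrict_axis_notin)
      have r': "is_axis C (u @ a' # v)"
        using is_axis_restrict_axis[OF ax, of a] C r by simp
      have "word (clone A) ax = word (clone A) (dup (restrict_axis a ax))" if "A \<subseteq> C" for A
      proof -
        have "a \<notin> A" using that C by auto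
        then show ?thesis
          unfolding r dup_word[OF that r'] using uv w1[OF nin, of A] w2[OF nin, of A] by metis
      qed
      then show "total_cost ?c P' ax = total_cost ?c2 P (restrict_axis a ax)"
        using P unfolding P'_def by (induction P) auto
    qed
    have int_dup: "is_interval {a, a'} (dup ax)" if ax: "is_axis C ax" for ax
    proof -
      obtain u v where uv: "ax = u @ a' # v" "distinct (u @ a' # v)" "a \<notin> set u" "a \<notin> set v"
        using split[OF ax] by blast
      then show ?thesis
        using is_interval_adjacent_pair[of u a' a v] dup[of u v] C by (auto simp: insert_commute)
    qed
    have mem: "ax \<in> f ?C (Q @ P') \<longleftrightarrow> is_axis ?C ax \<and>
      (\<forall>ax'. is_axis ?C ax' \<longrightarrow> total_cost ?c (Q @ P') ax \<le> total_cost ?c (Q @ P') ax')" for ax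
      using mem_rule_iff[OF g QP] .
    have con: "is_axis ?C ax" "is_interval {a, a'} ax" if "ax \<in> f ?C (Q @ P')" for ax
      using Q(2) that by (auto simp: con_def)
    have tot_dup: "total_cost ?c (Q @ P') (dup ax) = total_cost ?c2 P ax" if "is_axis C ax" for ax
      using tot_eq[of "dup ax"] Q0[of "dup ax"] dup_axis[OF that] int_dup[OF that] by simp
    have tot_f: "total_cost ?c (Q @ P') ax = total_cost ?c2 P (restrict_axis a ax)"
      if "ax \<in> f ?C (Q @ P')" for ax
      using tot_eq[OF con[OF that]] Q0[OF con[OF that]] by simp
    \<comment> \<open>Every axis on \<open>C\<close> competes through its duplicate, so the
      restriction of a selected axis is optimal on \<open>C\<close>.\<close>
    have le: "total_cost ?c2 P (restrict_axis a ax) \<le> total_cost ?c2 P ay"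
      if "ax \<in> f ?C (Q @ P')" "is_axis C ay" for ax ay
      using mem[of ax] that dup_axis(1)[OF that(2)] tot_f[OF that(1)] tot_dup[OF that(2)] by metis
    show ?thesis
    proof (intro equalityI subsetI)
      fix ax assume ax: "ax \<in> f C P"
      then obtain ay where "ay \<in> f ?C (Q @ P')" "restrict_axis a ay = ax" using bwd by blast
      then show "ax \<in> argmin_axes ?c2 C P"
        using le rule_axis[OF C(1) P ax] by (auto simp: argmin_axes_def)
    next
      fix ax assume "ax \<in> argmin_axes ?c2 C P"
      then have ax: "is_axis C ax" and min: "\<And>ay. is_axis C ay \<Longrightarrow> total_cost ?c2 P ax \<le> total_cost ?c2 P ay"
        by (auto simp: argmin_axes_def)
      \<comment> \<open>Any selected axis serves as a benchmark: the duplicate of a cheapest axis on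
        \<open>C\<close> costs no more, hence is selected too, and restricting it recovers
        \<open>ax\<close>.\<close>
      obtain ay where ay: "ay \<in> f ?C (Q @ P')" using rule_nonempty[OF finC QP] by blast
      have "is_axis C (restrict_axis a ay)"
        using is_axis_restrict_axis[OF con(1)[OF ay], of a] C by simp
      then have "total_cost ?c (Q @ P') (dup ax) \<le> total_cost ?c (Q @ P') ay"
        using min tot_dup[OF ax] tot_f[OF ay] by simp
      then have "dup ax \<in> f ?C (Q @ P')"
        using mem[of ay] mem[of "dup ax"] ay dup_axis(1)[OF ax] by (meson order_trans)
      then show "ax \<in> f C P" using fwd dup_axis(2)[OF ax] by force
    qed
  qed
  ultimately show "normal_cost f C ?c2" unfolding normal_cost_def induced_on_def by blast
  show "word (clone A) (dup (u @ a' # v)) = word A u @ (a' \<in> A) # (a' \<in> A) # word A v"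
    if "A \<subseteq> C" "is_axis C (u @ a' # v)" for A u v
    using dup_word that .
qed

text \<open>The cost of the duplicated axes is normal on a set of \<open>m\<close> candidates, so
  uniqueness makes it proportional to \<open>g\<close>. One factor serves every place of duplication
  because the cloned candidate is fixed while its place on the axis is arbitrary.\<close>

lemma word_cost_duplicate:
  assumes "3 \<le> m"
    and g: "\<And>C. finite C \<Longrightarrow> card C = m \<Longrightarrow> normal_cost f C (\<lambda>A ax. g (word A ax))"
    and g': "\<And>C. finite C \<Longrightarrow> card C = Suc m \<Longrightarrow> normal_cost f C (\<lambda>A ax. g' (word A ax))"
  obtains \<alpha> :: real where "0 < \<alpha>"
    "\<And>u b v. length (u @ b # v) = m \<Longrightarrow> True \<in> set (u @ b # v) \<Longrightarrow> g' (u @ b # b # v) = \<alpha> * g (u @ b # v)"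
proof -
  obtain C' :: "'a set" where C': "finite C'" "card C' = Suc m"
    using infinite_arbitrarily_large[OF infinite_UNIV] by blast
  then obtain a C where aC: "C' = insert a C" "a \<notin> C" "card C = m"
    by (metis card_Suc_eq)
  then have C: "finite C" using C' by simp
  obtain a' where a': "a' \<in> C" using aC assms(1) by fastforce
  define clone where "clone = (\<lambda>A. if a' \<in> A then insert a A else A)"
  define dup where "dup = (\<lambda>ax. concat (map (\<lambda>x. if x = a' then [a', a] else [x]) ax))"
  note gC' = g'[OF C'(1,2), unfolded aC(1)]
  have dup: "normal_cost f C (\<lambda>A ax. g' (word (clone A) (dup ax)))"
    "\<And>u v A. A \<subseteq> C \<Longrightarrow> is_axis C (u @ a' # v) \<Longrightarrow>
      word (clone A) (dup (u @ a' # v)) = word A u @ (a' \<in> A) # (a' \<in> A) # word A v"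
    using normal_cost_duplicate[OF C a' aC(2) gC'] unfolding clone_def dup_def by blast+
  obtain \<alpha> where \<alpha>: "0 < \<alpha>" "\<And>A ax. A \<noteq> {} \<Longrightarrow> A \<subseteq> C \<Longrightarrow> is_axis C ax \<Longrightarrow>
      g' (word (clone A) (dup ax)) = \<alpha> * g (word A ax)"
    using normal_cost_unique[OF C _ g[OF C aC(3)] dup(1)] aC(3) assms(1) by auto
  have "g' (u @ b # b # v) = \<alpha> * g (u @ b # v)"
    if len: "length (u @ b # v) = m" and T: "True \<in> set (u @ b # v)" for u b v
  proof -
    obtain l where l: "set l = C - {a'}" "distinct l" using C finite_distinct_list[of "C - {a'}"] by auto
    then have ll: "length l = m - 1" using a' aC C by (metis card_Diff_singleton distinct_card)
    define xs where "xs = take (length u) l"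
    define ys where "ys = drop (length u) l"
    have xs: "length xs = length u" using ll len by (simp add: xs_def)
    have ax: "is_axis C (xs @ a' # ys)"
    proof -
      have "distinct (xs @ ys)" "set (xs @ ys) = C - {a'}" using l by (simp_all add: xs_def ys_def)
      then show ?thesis using a' by (auto simp: is_axis_def)
    qed
    then obtain A where A: "A \<subseteq> C" "word A (xs @ a' # ys) = u @ b # v"
      using ex_word[of "xs @ a' # ys" "u @ b # v"] len is_axis_length[OF ax] aC(3) is_axis_def by metis
    then have w: "word A xs = u" "(a' \<in> A) = b" "word A ys = v" using xs by auto
    have "A \<noteq> {}" using T True_in_set_word[of A "xs @ a' # ys"] unfolding A(2) by auto
    then show ?thesis
      using \<alpha>(2)[OF _ A(1) ax] dup(2)[OF A(1) ax] w by simp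
  qed
  then show ?thesis using that \<alpha>(1) by blast
qed

text \<open>Dividing by the accumulated factors makes the word costs of all lengths compatible with
  duplicating a letter.\<close>

lemma ex_global_word_cost:
  obtains G :: "bool list \<Rightarrow> real" where
    "\<And>C. finite C \<Longrightarrow> 3 \<le> card C \<Longrightarrow> normal_cost f C (\<lambda>A ax. G (word A ax))"
    "\<And>u b v. 3 \<le> length (u @ b # v) \<Longrightarrow> True \<in> set (u @ b # v) \<Longrightarrow> G (u @ b # b # v) = G (u @ b # v)"
proof -
  have "\<forall>m. \<exists>g. 3 \<le> m \<longrightarrow> (\<forall>C. finite C \<longrightarrow> card C = m \<longrightarrow> normal_cost f C (\<lambda>A ax. g (word A ax)))"
    using ex_word_cost by metis
  then obtain g where g: "\<And>m C. 3 \<le> m \<Longrightarrow> finite C \<Longrightarrow> card C = m \<Longrightarrow> normal_cost f C (\<lambda>A ax. g m (word A ax))"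
    by metis
  have "\<forall>m. \<exists>\<alpha>::real. 3 \<le> m \<longrightarrow> 0 < \<alpha> \<and> (\<forall>u b v. length (u @ b # v) = m \<longrightarrow> True \<in> set (u @ b # v) \<longrightarrow>
      g (Suc m) (u @ b # b # v) = \<alpha> * g m (u @ b # v))"
  proof
    fix m
    show "\<exists>\<alpha>::real. 3 \<le> m \<longrightarrow> 0 < \<alpha> \<and> (\<forall>u b v. length (u @ b # v) = m \<longrightarrow> True \<in> set (u @ b # v) \<longrightarrow>
      g (Suc m) (u @ b # b # v) = \<alpha> * g m (u @ b # v))"
      using word_cost_duplicate[of m "g m" "g (Suc m)"] g by (metis le_SucI)
  qed
  then obtain \<alpha> :: "nat \<Rightarrow> real" where \<alpha>: "\<And>m. 3 \<le> m \<Longrightarrow> 0 < \<alpha> m"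
    "\<And>m u b v. 3 \<le> m \<Longrightarrow> length (u @ b # v) = m \<Longrightarrow> True \<in> set (u @ b # v) \<Longrightarrow>
      g (Suc m) (u @ b # b # v) = \<alpha> m * g m (u @ b # v)"
    by metis
  \<comment> \<open>From 3 on \<open>S (Suc m) = S m * \<alpha> m\<close>, which cancels exactly the
    factor that a duplication introduces.\<close>
  define S where "S m = (\<Prod>j = 3..<m. \<alpha> j)" for m
  have S: "0 < S m" for m unfolding S_def using \<alpha>(1) by (intro prod_pos) auto
  define G where "G w = g (length w) w / S (length w)" for w
  show ?thesis
  proof
    fix C :: "'a set" assume C: "finite C" "3 \<le> card C"
    show "normal_cost f C (\<lambda>A ax. G (word A ax))"
      by (rule normal_cost_cong[OF normal_cost_divide[OF g[OF C(2,1) refl] S[of "card C"]]])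
        (simp add: G_def is_axis_length)
  next
    fix u v and b assume *: "3 \<le> length (u @ b # v)" "True \<in> set (u @ b # v)"
    let ?m = "length (u @ b # v)"
    have "S (Suc ?m) = S ?m * \<alpha> ?m" using *(1) by (simp add: S_def)
    then show "G (u @ b # b # v) = G (u @ b # v)"
      using \<alpha>(2)[OF *(1) refl *(2)] \<alpha>(1)[OF *(1)] by (simp add: G_def)
  qed
qed

end

section \<open>Clearance and the two hole functions\<close>

text \<open>The word 1(01)^n is the contracted form of a ballot with \<open>n\<close> holes that
  holds both ends; with a leading False it will stand for all ballots that miss an end.\<close>

primrec star :: "nat \<Rightarrow> bool list" where
  "star 0 = [True]"
| "star (Suc n) = True # False # star n"

lemma star_simps [simp]:
  "length (star n) = Suc (2 * n)" "True \<in> set (star n)" "star n \<noteq> []" "hd (star n)" "last (star n)"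
  "holes (star n) = n" "holes (True # star n) = n"
  by (induction n) auto

lemma star_snoc: "star n @ [False, True] = star (Suc n)"
  by (induction n) auto

lemma rev_star [simp]: "rev (star n) = star n"
proof (induction n)
  case (Suc n)
  then show ?case using star_snoc[of n] by simp
qed simp

lemma holes_star_snoc [simp]: "holes (star n @ [True]) = n"
  by (induction n) auto

lemma star_if_distinct_adj:
  assumes "distinct_adj (True # w)"
  obtains n where "True # w = star n" | n where "True # w = star n @ [False]"
proof -
  have "\<exists>n. True # w = star n \<or> True # w = star n @ [False]"
    using assms
  proof (induction "length w" arbitrary: w rule: less_induct)
    case less
    show ?case
    proof (cases w)
      case Nil
      then show ?thesis by (intro exI[of _ 0]) auto
    next
      case (Cons y v)
      show ?thesis
      proof (cases v)
        case Nil
        then show ?thesis using less.prems Cons by (intro exI[of _ 0]) auto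
      next
        case (Cons z t)
        then have "w = False # True # t" using less.prems \<open>w = y # v\<close> by auto
        moreover obtain n where "True # t = star n \<or> True # t = star n @ [False]"
          using less.hyps[of t] less.prems calculation by auto
        ultimately show ?thesis by (intro exI[of _ "Suc n"]) auto
      qed
    qed
  qed
  then show ?thesis using that by blast
qed

section \<open>Profiles that fix an axis up to reversal\<close>

lemma con_Cons:
  assumes "ax \<in> con C L" "x \<notin> C" "is_profile C L"
  shows "x # ax \<in> con (insert x C) L"
proof -
  have ax: "distinct (x # ax)" "set ax = C" using assms by (auto simp: con_def is_axis_def)
  have "is_interval A (x # ax)" if "A \<in> set L" for A
  proof -
    have "x \<notin> A" using assms that by (auto simp: is_profile_def)
    moreover have "is_interval A ax" using assms that by (simp add: con_def)
    ultimately show ?thesis using ax is_interval_iff_holes[of ax A] is_interval_iff_holes[of "x # ax" A]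
      by simp
  qed
  then show ?thesis using ax by (auto simp: con_def is_axis_def)
qed

lemma con_restrict_axis:
  assumes "ax \<in> con C L"
  shows "restrict_axis x ax \<in> con (C - {x}) (remove_cand x L)"
  using assms is_interval_restrict_axis is_axis_restrict_axis
  by (fastforce simp: con_def remove_cand_def)

lemma con_restrict_axis_notin:
  assumes "ax \<in> con (insert x C) L" "x \<notin> C" "is_profile C L"
  shows "restrict_axis x ax \<in> con C L"
proof -
  have "is_interval A (restrict_axis x ax)" if "A \<in> set L" for A
  proof -
    have "A - {x} = A" using assms that by (auto simp: is_profile_def)
    moreover have "is_interval A ax" using assms that by (simp add: con_def)
    ultimately show ?thesis using is_interval_restrict_axis[of A ax x] by simp
  qed
  moreover have "is_axis C (restrict_axis x ax)"
    using is_axis_restrict_axis[of "insert x C" ax x] assms by (simp add: con_def)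
  ultimately show ?thesis by (simp add: con_def)
qed

lemma is_profile_remove_cand: "is_profile C P \<Longrightarrow> is_profile (C - {x}) (remove_cand x P)"
  by (auto simp: is_profile_def remove_cand_def)

text \<open>The ballot \<open>set Y\<close> is an interval of every axis on \<open>set Y\<close>. It
  acts on larger candidate sets, where it keeps further candidates from standing between those of
  \<open>Y\<close>.\<close>

definition rigid :: "'a list \<Rightarrow> 'a set list" where
  "rigid Y = cuts Y [1..<length Y] @ [set Y]"

lemma is_profile_rigid: "Y \<noteq> [] \<Longrightarrow> is_profile (set Y) (rigid Y)"
  using is_profile_cuts[of "[1..<length Y]" Y "set Y"] by (simp add: rigid_def)

lemma con_rigid:
  assumes "distinct Y"
  shows "con (set Y) (rigid Y) = {Y, rev Y}"
proof -
  have Y: "is_axis (set Y) Y" using assms by (simp add: is_axis_def)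
  have mem: "Y \<in> con (set Y) (rigid Y)"
    using con_cutsI[OF Y Y, of "[1..<length Y]"] is_interval_take_drop(1)[OF assms, of "length Y"]
    by (auto simp: rigid_def con_def)
  have eq: "ax = Y" if ax: "is_axis (set Y) ax" and t: "\<forall>i \<in> set [1..<length Y]. set (take i ax) = set (take i Y)" for ax
  proof (rule nth_equalityI)
    show len: "length ax = length Y" using is_axis_length[OF ax] is_axis_length[OF Y] by simp
    have t': "set (take i ax) = set (take i Y)" if "i \<le> length Y" for i
    proof (cases "i = 0 \<or> i = length Y")
      case True
      then show ?thesis using ax len by (auto simp: is_axis_def)
    qed (use t that in auto)
    fix i assume "i < length ax"
    then show "ax ! i = Y ! i"
      using nth_eq_if_take_eq[of ax Y i] t'[of i] t'[of "Suc i"] ax assms len by (auto simp: is_axis_def)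
  qed
  have "ax = Y \<or> ax = rev Y" if "ax \<in> con (set Y) (rigid Y)" for ax
  proof -
    have ax: "is_axis (set Y) ax" "ax \<in> con (set Y) (cuts Y [1..<length Y])"
      using that by (auto simp: con_def rigid_def)
    then show ?thesis
      using con_cutsD[OF Y _ ax(2)] eq[of ax] eq[of "rev ax"] by (auto simp: is_axis_rev)
  qed
  then show ?thesis using mem con_rev[OF mem] by blast
qed

lemma extreme_if_is_interval:
  assumes "is_axis (insert x C) ax" "x \<notin> C" "C \<noteq> {}" "is_interval C ax"
  shows "ax = x # restrict_axis x ax \<or> ax = restrict_axis x ax @ [x]"
proof (rule extreme_if_outside)
  let ?r = "restrict_axis x ax"
  have "set ?r = C" using is_axis_restrict_axis[OF assms(1), of x] assms(2) by (simp add: is_axis_def)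
  moreover from this have "?r \<noteq> []" using assms(3) by auto
  ultimately have "hd ?r \<in> C" "last ?r \<in> C" using hd_in_set last_in_set by blast+
  then show "\<not> (before ax (hd ?r) x \<and> before ax x (last ?r))"
    using assms(2,4) unfolding is_interval_def by blast
qed (use assms in \<open>auto simp: is_axis_def\<close>)

lemma clears_extreme:
  assumes "distinct (x # r)"
  shows "clears P {x} (x # r)" "clears P {x} (r @ [x])"
proof -
  have "\<not> before (x # r) y x" for y
    using assms by (auto simp: before_def nth_Cons split: nat.splits)
  then show "clears P {x} (x # r)" by (simp add: clears_def)
  have "\<not> before (r @ [x]) x z" for z
    using assms nth_mem[of _ r] by (auto simp: before_def nth_append)
  then show "clears P {x} (r @ [x])" by (simp add: clears_def)
qed

section \<open>Values of a word cost that is invariant under duplication\<close>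

locale word_cost = linear_scoring_rule +
  fixes G :: "bool list \<Rightarrow> real"
  assumes G_normal: "\<And>C. finite C \<Longrightarrow> 3 \<le> card C \<Longrightarrow> normal_cost f C (\<lambda>A ax. G (word A ax))"
    and G_duplicate: "\<And>u b v. 3 \<le> length (u @ b # v) \<Longrightarrow> True \<in> set (u @ b # v) \<Longrightarrow>
      G (u @ b # b # v) = G (u @ b # v)"
begin

text \<open>The prefix \<open>u\<close> collects the letters already treated. The length bound is on
  the contracted word, so that three letters remain at every removal and \<open>G_duplicate\<close>
  applies.\<close>

lemma G_remdups_adj:
  "3 \<le> length (u @ remdups_adj w) \<Longrightarrow> True \<in> set (u @ w) \<Longrightarrow> G (u @ w) = G (u @ remdups_adj w)"
proof (induction w arbitrary: u rule: remdups_adj.induct)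
  case (3 x y xs)
  show ?case
  proof (cases "x = y")
    case True
    have "length (remdups_adj (x # xs)) \<le> length (x # xs)" by (rule remdups_adj_length)
    then have "G (u @ x # x # xs) = G (u @ x # xs)"
      using 3 True by (intro G_duplicate) auto
    then show ?thesis using 3 True by simp
  next
    case False
    then show ?thesis using 3(2)[OF False, of "u @ [x]"] 3(3,4) by simp
  qed
qed auto

lemma ex_fresh_list:
  obtains xs :: "'a list" where "distinct xs" "length xs = n"
  using infinite_arbitrarily_large[OF infinite_UNIV, of n] finite_distinct_list distinct_card by metis

text \<open>A never approved \<open>x\<close> is added to a rigid \<open>Y\<close> on which
  \<open>A\<close> has the word \<open>w\<close>. Clearance selects both axes with \<open>x\<close>
  at an end, and since the forcing ballots are free on selected axes, the two costs of
  \<open>A\<close> coincide.\<close>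

lemma G_shift:
  assumes "2 \<le> length w" "True \<in> set w"
  shows "G (False # w) = G (w @ [False])"
proof -
  obtain xs :: "'a list" where xs: "distinct xs" "length xs = Suc (length w)" using ex_fresh_list by blast
  then obtain x Y where xY: "xs = x # Y" by (cases xs) auto
  define C where "C = insert x (set Y)"
  have Y: "distinct Y" "length Y = length w" "x \<notin> set Y" "Y \<noteq> []" using xs xY assms by auto
  have C: "finite C" "3 \<le> card C" using Y assms by (auto simp: C_def distinct_card)
  obtain A where A: "A \<subseteq> set Y" "word A Y = w" using ex_word[of Y w] Y by auto
  have "A \<noteq> {}" using assms(2) True_in_set_word[of A Y] A by auto
  then have profA: "is_profile C [A]" using A by (auto simp: C_def)
  have profL: "is_profile C (rigid Y)" using is_profile_rigid[OF Y(4)] by (auto simp: is_profile_def C_def)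
  have con: "con C (rigid Y) \<noteq> {}"
    using con_Cons[OF _ Y(3) is_profile_rigid[OF Y(4)]] con_rigid[OF Y(1)] unfolding C_def by blast
  note c = G_normal[OF C]
  obtain Q where Q: "set Q = set (rigid Y)" "f C (Q @ [A]) \<subseteq> con C (rigid Y)"
    using ex_forcing_profile[OF C(1) c profL con profA] by blast
  have profQ: "is_profile C Q" using is_profile_cong[OF Q(1)] profL by simp
  have prof: "is_profile C (Q @ [A])" using profQ profA by simp
  have "\<Union> (set (Q @ [A])) = set Y"
    using A is_profile_rigid[OF Y(4)] by (auto simp: Q(1) is_profile_def) (auto simp: rigid_def)
  then have X: "C - \<Union> (set (Q @ [A])) = {x}" using Y(3) by (auto simp: C_def)
  obtain ax where ax: "ax \<in> f C (Q @ [A])" and clear: "\<And>ax'. is_axis C ax' \<Longrightarrow> clears (Q @ [A]) {x} ax' \<Longrightarrow>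
      filter (\<lambda>y. y \<notin> {x}) ax' = filter (\<lambda>y. y \<notin> {x}) ax \<Longrightarrow> ax' \<in> f C (Q @ [A])"
    using clearance[unfolded inclusion_clearance_def Let_def, rule_format, OF C(1) prof] unfolding X by blast
  define r where "r = restrict_axis x ax"
  have r_filter: "r = filter (\<lambda>y. y \<notin> {x}) ax" by (simp add: r_def restrict_axis_def)
  have axcon: "ax \<in> con (insert x (set Y)) (rigid Y)" using ax Q(2) by (auto simp: C_def)
  have r: "r = Y \<or> r = rev Y"
    using con_restrict_axis_notin[OF axcon Y(3) is_profile_rigid[OF Y(4)]] con_rigid[OF Y(1)]
    by (simp add: r_def)
  then have rr: "distinct r" "set r = set Y" using Y by auto
  have "x # r \<in> f C (Q @ [A])" "r @ [x] \<in> f C (Q @ [A])"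
  proof -
    have "is_axis C (x # r)" "is_axis C (r @ [x])" using rr Y(3) by (auto simp: is_axis_def C_def)
    moreover have "filter (\<lambda>y. y \<notin> {x}) r = r" using rr Y(3) by (auto simp: filter_id_conv)
    ultimately show "x # r \<in> f C (Q @ [A])" "r @ [x] \<in> f C (Q @ [A])"
      using clear[of "x # r"] clear[of "r @ [x]"] clears_extreme[of x r] rr Y(3)
      unfolding r_filter[symmetric] by auto
  qed
  \<comment> \<open>If the order found is \<open>rev Y\<close>, reversing the two selected axes
    exchanges the two ends.\<close>
  then have mem: "x # Y \<in> f C (Q @ [A])" "Y @ [x] \<in> f C (Q @ [A])"
    using r rule_rev[OF C(1) prof] by fastforce+
  have cost: "total_cost (\<lambda>A ax. G (word A ax)) (Q @ [A]) ay = G (word A ay)" if "ay \<in> f C (Q @ [A])" for ay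
  proof -
    have "ay \<in> con C Q" using that Q con_cong[OF Q(1), of C] by blast
    then show ?thesis
      using total_cost_eq_0_iff[OF c profQ, of ay] rule_axis[OF C(1) prof that] by simp
  qed
  have "G (word A (x # Y)) = G (word A (Y @ [x]))"
    using mem mem_rule_iff[OF c prof] cost by (metis order.antisym)
  moreover have "x \<notin> A" using A Y by auto
  ultimately show ?thesis using A by simp
qed

lemma G_eq_star:
  assumes "holes w = n" "1 \<le> n"
  shows "G w = (if hd w \<and> last w then G (star n) else G (False # star n))"
proof -
  define r where "r = remdups_adj w"
  have ne: "w \<noteq> []" using assms by auto
  have T: "True \<in> set w"
  proof (rule ccontr)
    assume "True \<notin> set w"
    then have "holes w = 0" by (induction w rule: holes.induct) auto
    then show False using assms by simp
  qed
  have hn: "holes r = n" using assms by (simp add: r_def holes_remdups_adj)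
  have hl: "hd r = hd w" "last r = last w" using ne by (simp_all add: r_def hd_remdups_adj)
  have da: "distinct_adj r" by (simp add: r_def)
  have "r = star n \<or> r = star n @ [False] \<or> r = False # star n \<or> r = False # star n @ [False]"
  proof -
    have *: "v = star n \<or> v = star n @ [False]" if "v = True # t" "distinct_adj v" "holes v = n" for v t
      using that by (metis holes_snoc_False star_if_distinct_adj star_simps(6))
    obtain b t where r: "r = b # t" using ne by (cases r) (auto simp: r_def)
    show ?thesis
    proof (cases b)
      case True
      then show ?thesis using *[of r t] r da hn by auto
    next
      case False
      then have "holes t = n" using hn r by simp
      then have "t \<noteq> []" using assms by auto
      then obtain s where "t = True # s" using da r False by (cases t) auto
      then show ?thesis using *[of t s] r da hn False by auto
    qed
  qed
  moreover have "G w = G r"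
  proof -
    have "3 \<le> length r" using calculation assms by auto
    then show ?thesis using G_remdups_adj[of "[]" w] T by (simp add: r_def)
  qed
  moreover have "G (star n @ [False]) = G (False # star n)"
    using G_shift[of "star n"] assms by simp
  \<comment> \<open>The last False is shifted to the front, where it merges with the leading
    one.\<close>
  moreover have "G (False # star n @ [False]) = G (False # star n)"
    using G_shift[of "False # star n"] G_duplicate[of "[]" False "star n"] assms by simp
  ultimately show ?thesis unfolding hl[symmetric] by auto
qed

text \<open>On \<open>y # x # Y\<close> the unapproved \<open>x\<close> makes a hole beside the
  approved \<open>y\<close>, giving \<open>star (Suc n)\<close>. Clearance selects an axis with
  \<open>x\<close> at an end, where this hole is gone but an end is missing; being optimal, that
  axis costs no more.\<close>

lemma G_star_le_Suc:
  assumes "1 \<le> n"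
  shows "G (False # star n) \<le> G (star (Suc n))"
proof -
  obtain xs :: "'a list" where xs: "distinct xs" "length xs = Suc (Suc (length (star n)))"
    using ex_fresh_list by blast
  then obtain x y Y where xY: "xs = x # y # Y" by (metis length_Suc_conv)
  define D where "D = insert y (set Y)"
  define C where "C = insert x D"
  have Y: "distinct Y" "length Y = length (star n)" "y \<notin> set Y" "x \<notin> D" "Y \<noteq> []"
    using xs xY by (auto simp: D_def)
  have C: "finite C" "3 \<le> card C" using Y assms by (auto simp: C_def D_def distinct_card)
  obtain A0 where A0: "A0 \<subseteq> set Y" "word A0 Y = star n" using ex_word[of Y "star n"] Y by auto
  define A where "A = insert y A0"
  have AY: "word A Y = star n" using A0 Y(3) word_cong[of Y A A0] by (auto simp: A_def)
  have A: "y \<in> A" "x \<notin> A" "A \<subseteq> D" using A0 Y by (auto simp: A_def D_def)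
  have profA: "is_profile C [A]" using A by (auto simp: C_def)
  note profY = is_profile_rigid[OF Y(5)]
  have profL: "is_profile C (rigid Y)" "is_profile D (rigid Y)"
    using profY by (auto simp: is_profile_def C_def D_def)
  have mem: "y # x # Y \<in> con C (rigid Y)"
  proof -
    have Yc: "Y \<in> con (set Y) (rigid Y)" using con_rigid[OF Y(1)] by simp
    have "x \<notin> set Y" "y \<notin> insert x (set Y)" using Y xs xY by (auto simp: D_def)
    moreover from this have "x # Y \<in> con (insert x (set Y)) (rigid Y)" using con_Cons[OF Yc _ profY] by simp
    moreover have "is_profile (insert x (set Y)) (rigid Y)" using profY by (auto simp: is_profile_def)
    ultimately have "y # x # Y \<in> con (insert y (insert x (set Y))) (rigid Y)" using con_Cons by metis
    then show ?thesis by (simp add: C_def D_def insert_commute)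
  qed
  note c = G_normal[OF C]
  obtain Q where Q: "set Q = set (rigid Y)" "f C (Q @ [A]) \<subseteq> con C (rigid Y)"
    using ex_forcing_profile[OF C(1) c profL(1) _ profA] mem by blast
  have profQ: "is_profile C Q" using is_profile_cong[OF Q(1)] profL by simp
  have prof: "is_profile C (Q @ [A])" using profQ profA by simp
  have "\<Union> (set (Q @ [A])) = D"
    using A profY by (auto simp: Q(1) is_profile_def D_def) (auto simp: rigid_def)
  then have X: "C - \<Union> (set (Q @ [A])) = {x}" using Y(4) by (auto simp: C_def)
  obtain ax where ax: "ax \<in> f C (Q @ [A])" and clear: "clears (Q @ [A]) {x} ax"
    using clearance[unfolded inclusion_clearance_def Let_def, rule_format, OF C(1) prof] unfolding X by blast
  have axis: "is_axis C ax" using rule_axis[OF C(1) prof ax] .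
  have axcon: "ax \<in> con (insert x D) (rigid Y)" using ax Q(2) by (auto simp: C_def)
  define r where "r = restrict_axis x ax"
  define s where "s = restrict_axis y r"
  have rcon: "r \<in> con (insert y (set Y)) (rigid Y)"
    using con_restrict_axis_notin[OF axcon Y(4) profL(2)] by (simp add: r_def D_def)
  have s: "s = Y \<or> s = rev Y"
    using con_restrict_axis_notin[OF rcon Y(3) profY] con_rigid[OF Y(1)] by (simp add: s_def)
  then have sA: "word A s = star n" using AY by (auto simp: word_rev)
  have "is_interval (set Y) r" using rcon by (simp add: con_def rigid_def)
  \<comment> \<open>\<open>y\<close> is approved and stands beside an approved end of
    \<open>Y\<close>, so it merely duplicates a letter.\<close>
  then have "r = y # s \<or> r = s @ [y]"
    using extreme_if_is_interval[of y "set Y" r] rcon Y by (simp add: s_def con_def)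
  then have rA: "word A r = True # star n \<or> word A r = star n @ [True]" using sA A by auto
  then have rne: "r \<noteq> []" by auto
  have "hd (word A r)" "last (word A r)" using rA by auto
  then have "hd r \<in> A" "last r \<in> A" using rne by (auto simp: word_def hd_map last_map)
  then have "\<not> (before ax (hd r) x \<and> before ax x (last r))" using clear by (auto simp: clears_def)
  then have "ax = x # r \<or> ax = r @ [x]"
    using extreme_if_outside[of ax x] axis by (auto simp: is_axis_def C_def r_def)
  then have "word A ax = False # word A r \<or> word A ax = word A r @ [False]" using A by auto
  then have "holes (word A ax) = holes (word A r)" "\<not> (hd (word A ax) \<and> last (word A ax))" by auto
  moreover have "holes (word A r) = n" using rA by auto
  ultimately have "G (word A ax) = G (False # star n)"
    using G_eq_star[of "word A ax" n] assms by auto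
  moreover have "total_cost (\<lambda>A ax. G (word A ax)) (Q @ [A]) ax = G (word A ax)"
  proof -
    have "ax \<in> con C Q" using ax Q con_cong[OF Q(1), of C] by blast
    then show ?thesis using total_cost_eq_0_iff[OF c profQ axis] by simp
  qed
  moreover have "total_cost (\<lambda>A ax. G (word A ax)) (Q @ [A]) (y # x # Y) = G (star (Suc n))"
  proof -
    have "y # x # Y \<in> con C Q" "is_axis C (y # x # Y)" using mem con_cong[OF Q(1), of C] by (auto simp: con_def)
    then show ?thesis using total_cost_eq_0_iff[OF c profQ] A AY by simp
  qed
  moreover have "is_axis C (y # x # Y)" using mem by (simp add: con_def)
  ultimately show ?thesis using ax mem_rule_iff[OF c prof] by metis
qed

text \<open>If duplicating a hole next to the leftmost candidate of a starred ballot and moving the copy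
  to the left end were profitable, then the restricted axis would be selected although swapping its
  first two candidates improves it.\<close>

lemma G_star_le:
  assumes "1 \<le> n"
  shows "G (star n) \<le> G (False # star n)"
proof (rule ccontr)
  assume "\<not> ?thesis"
  then have lt: "G (False # star n) < G (star n)" by simp
  \<comment> \<open>Layout: \<open>y\<close> followed by \<open>Z\<close>, whose word is
    \<open>False # star k\<close>, makes up \<open>star n\<close>; \<open>a\<close> and
    \<open>a'\<close> are unapproved clones that may stand on either side of
    \<open>y\<close>.\<close>
  obtain k where k: "n = Suc k" using assms by (cases n) auto
  obtain xs :: "'a list" where xs: "distinct xs" "length xs = 4 + length (star k)"
    using ex_fresh_list by blast
  then obtain a a' y Z where xZ: "xs = a # a' # y # Z"
    by (metis (no_types, lifting) add_Suc length_Suc_conv numeral_Bit0 numeral_One one_add_one plus_1_eq_Suc)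
  define C where "C = set xs"
  let ?Y = "a # a' # y # Z"
  have d: "distinct ?Y" "length Z = Suc (length (star k))" using xs xZ by auto
  have Y: "is_axis C ?Y" using xs xZ by (auto simp: is_axis_def C_def)
  have C: "finite C" "3 \<le> card C" "finite (C - {a})" "3 \<le> card (C - {a})"
    using is_axis_length[OF Y] d Y by (auto simp: C_def is_axis_def xZ card_insert_if distinct_card)
  obtain A0 where A0: "A0 \<subseteq> set Z" "word A0 Z = False # star k"
    using ex_word[of Z "False # star k"] d by auto
  define A where "A = insert y A0"
  have AZ: "word A Z = False # star k" using A0 d word_cong[of Z A A0] by (auto simp: A_def)
  have A: "y \<in> A" "a \<notin> A" "a' \<notin> A" "A \<subseteq> C" "A \<noteq> {}" using A0 d by (auto simp: A_def C_def xZ)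
  \<comment> \<open>With no cut before position 3, the candidates \<open>a\<close>,
    \<open>a'\<close>, \<open>y\<close> may be permuted while the rest is fixed.\<close>
  define I where "I = [3..<length ?Y]"
  have I: "\<forall>i \<in> set I. 0 < i \<and> i < length ?Y" by (auto simp: I_def)
  define L where "L = cuts ?Y I"
  have profL: "is_profile C L" unfolding L_def using I by (intro is_profile_cuts) (auto simp: C_def xZ)
  have take3: "set (take i (p # q # t # Z)) = set (take i ?Y)" if "{p, q, t} = {a, a', y}" "i \<in> set I" for p q t i
  proof -
    have "i = Suc (Suc (Suc (i - 3)))" using that(2) by (auto simp: I_def)
    then obtain j where "i = Suc (Suc (Suc j))" by blast
    moreover have "insert p (insert q (insert t B)) = {p, q, t} \<union> B" for B by auto
    ultimately show ?thesis using that(1) by auto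
  qed
  have conI: "p # q # t # Z \<in> con C L" if "{p, q, t} = {a, a', y}" "distinct [p, q, t]" for p q t
  proof -
    have "set (p # q # t # Z) = {p, q, t} \<union> set Z" by auto
    then have "is_axis C (p # q # t # Z)" using Y that d by (auto simp: is_axis_def)
    then show ?thesis unfolding L_def using Y take3[OF that(1)] by (intro con_cutsI) auto
  qed
  have con: "a # y # a' # Z \<in> con C L" "a # a' # y # Z \<in> con C L"
    using d by (auto intro!: conI)
  have profA: "is_profile C [A]" using A by simp
  note c = G_normal[OF C(1,2)] and c' = G_normal[OF C(3,4)]
  obtain Q where Q: "set Q = set L" "f C (Q @ [A]) \<subseteq> con C L"
    using ex_forcing_profile[OF C(1) c profL _ profA] con(1) by blast
  have profQ: "is_profile C Q" using is_profile_cong[OF Q(1)] profL by simp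
  have prof: "is_profile C (Q @ [A])" using profQ profA by simp
  have cost: "total_cost (\<lambda>A ax. G (word A ax)) (Q @ [A]) ax = G (word A ax)" if "ax \<in> con C L" for ax
  proof -
    have "ax \<in> con C Q" "is_axis C ax" using that con_cong[OF Q(1), of C] by (auto simp: con_def)
    then show ?thesis using total_cost_eq_0_iff[OF c profQ] by simp
  qed
  have front: "\<exists>p q t. ax = p # q # t # Z \<and> {p, q, t} = {a, a', y}"
    if ax: "is_axis C ax" and eq: "\<forall>i \<in> set I. set (take i ax) = set (take i ?Y)" for ax
  proof -
    have len: "length ax = length ?Y" using is_axis_length[OF ax] is_axis_length[OF Y] by simp
    then obtain p q t R where ax': "ax = p # q # t # R" by (auto simp: length_Suc_conv)
    have t': "set (take i ax) = set (take i ?Y)" if "3 \<le> i" "i \<le> length ?Y" for i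
    proof (cases "i = length ?Y")
      case True
      then show ?thesis using ax Y len by (simp add: is_axis_def)
    next
      case False
      then have "i \<in> set I" using that unfolding I_def set_upt by simp
      then show ?thesis using eq by blast
    qed
    have "R = Z"
    proof (rule nth_equalityI)
      show "length R = length Z" using len ax' by simp
      fix i assume "i < length R"
      then have "ax ! (i + 3) = ?Y ! (i + 3)"
        using nth_eq_if_take_eq[of ax ?Y "i + 3"] t'[of "i + 3"] t'[of "Suc (i + 3)"] ax d len ax'
        by (auto simp: is_axis_def)
      then show "R ! i = Z ! i" using ax' by (simp add: numeral_3_eq_3)
    qed
    moreover have "{p, q, t} = {a, a', y}"
      using t'[of 3] ax' by (simp add: numeral_3_eq_3)
    ultimately show ?thesis using ax' by blast
  qed
  \<comment> \<open>In every order of the three front candidates \<open>A\<close> has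
    \<open>n\<close> holes, so it costs one of two values; by assumption the one with an end missing
    is the smaller.\<close>
  have ge: "G (False # star n) \<le> G (word A (p # q # t # Z))"
    if "{p, q, t} = {a, a', y}" "distinct [p, q, t]" for p q t
  proof -
    have "x \<in> A \<longleftrightarrow> x = y" if "x \<in> {a, a', y}" for x using that A by auto
    then have "p \<in> A \<longleftrightarrow> p = y" "q \<in> A \<longleftrightarrow> q = y" "t \<in> A \<longleftrightarrow> t = y"
      unfolding that(1)[symmetric] by simp_all
    moreover have "y \<in> {p, q, t}" unfolding that(1) by simp
    ultimately have "word A [p, q, t] \<in> {[True, False, False], [False, True, False], [False, False, True]}"
      using that(2) by auto
    then have "word A (p # q # t # Z) = True # False # False # False # star k \<or>
        word A (p # q # t # Z) = False # True # False # False # star k \<or>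
        word A (p # q # t # Z) = False # False # True # False # star k"
      using AZ by auto
    then have "holes (word A (p # q # t # Z)) = n" using k by auto
    then show ?thesis using G_eq_star[of "word A (p # q # t # Z)" n] assms lt by auto
  qed
  \<comment> \<open>Placing the clones on both sides of \<open>y\<close> attains this minimum but,
    unlike \<open>a # a' # y # Z\<close>, loses the advantage when \<open>a\<close> is
    removed.\<close>
  have wa: "G (word A (a # y # a' # Z)) = G (False # star n)"
    using G_eq_star[of "word A (a # y # a' # Z)" n] assms A AZ k by auto
  obtain ax where ax: "ax \<in> f C (Q @ [A])" using rule_nonempty[OF C(1) prof] by blast
  have revax: "rev ax \<in> f C (Q @ [A])" using rule_rev[OF C(1) prof ax] .
  have "(\<forall>i \<in> set I. set (take i ax) = set (take i ?Y)) \<or>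
      (\<forall>i \<in> set I. set (take i (rev ax)) = set (take i ?Y))"
    using con_cutsD[OF Y I] ax Q(2) unfolding L_def by blast
  then obtain ay where ay: "ay \<in> f C (Q @ [A])" "\<forall>i \<in> set I. set (take i ay) = set (take i ?Y)"
    using ax revax by blast
  obtain p q t where pqt: "ay = p # q # t # Z" "{p, q, t} = {a, a', y}"
    using front[OF rule_axis[OF C(1) prof ay(1)] ay(2)] by blast
  have "distinct [p, q, t]" using rule_axis[OF C(1) prof ay(1)] pqt by (auto simp: is_axis_def)
  then have "G (False # star n) \<le> G (word A ay)" using ge pqt by simp
  then have "total_cost (\<lambda>A ax. G (word A ax)) (Q @ [A]) (a # y # a' # Z)
      \<le> total_cost (\<lambda>A ax. G (word A ax)) (Q @ [A]) ay"
    using wa cost[OF con(1)] cost[of ay] ay(1) Q(2) by auto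
  moreover have "is_axis C (a # y # a' # Z)" using con by (simp add: con_def)
  ultimately have "a # y # a' # Z \<in> f C (Q @ [A])"
    using mem_rule_iff[OF c prof] ay(1) by (meson order_trans)
  moreover have "clones (Q @ [A]) a a'"
  proof -
    \<comment> \<open>Every cut lies behind all three front candidates, so no forcing ballot
      separates \<open>a\<close> from \<open>a'\<close>.\<close>
    have "a \<in> B \<longleftrightarrow> a' \<in> B" if B: "B \<in> set L" for B
    proof -
      obtain i where "i \<in> set I" "B = set (take i ?Y) \<or> B = set (drop i ?Y)"
        using B by (auto simp: L_def cuts_def)
      moreover from this have "i = Suc (Suc (Suc (i - 3)))" by (auto simp: I_def)
      then obtain j where "i = Suc (Suc (Suc j))" by blast
      ultimately show ?thesis using d by (auto dest: in_set_dropD)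
    qed
    then show ?thesis using A by (auto simp: clones_def Q(1))
  qed
  moreover have "a \<in> C" "a' \<in> C" "a \<noteq> a'" using d by (auto simp: C_def xZ)
  ultimately have "restrict_axis a (a # y # a' # Z) \<in> f (C - {a}) (remove_cand a (Q @ [A]))"
    using cloning[unfolded resistant_to_cloning_def, rule_format, of C "Q @ [A]" a a'] C(1) prof by blast
  moreover have "remove_cand a (Q @ [A]) = remove_cand a Q @ [A]" using A by (simp add: remove_cand_def)
  moreover have r: "restrict_axis a (a # y # a' # Z) = y # a' # Z" "restrict_axis a (a # a' # y # Z) = a' # y # Z"
    using d by (auto simp: restrict_axis_notin)
  ultimately have sel: "y # a' # Z \<in> f (C - {a}) (remove_cand a Q @ [A])" by simp
  have profR: "is_profile (C - {a}) (remove_cand a Q)" "is_profile (C - {a}) (remove_cand a Q @ [A])"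
    using is_profile_remove_cand[OF profQ] A by auto
  have conR: "y # a' # Z \<in> con (C - {a}) (remove_cand a Q)" "a' # y # Z \<in> con (C - {a}) (remove_cand a Q)"
    using con_restrict_axis[of "a # y # a' # Z" C Q a] con_restrict_axis[of "a # a' # y # Z" C Q a]
      con unfolding r con_cong[OF Q(1), of C] by blast+
  then have ax2: "is_axis (C - {a}) (y # a' # Z)" "is_axis (C - {a}) (a' # y # Z)" by (auto simp: con_def)
  \<comment> \<open>The axis left after removing \<open>a\<close> is selected, so it must be at most
    as dear as its swap; the assumption says the opposite.\<close>
  have "G (word A (y # a' # Z)) \<le> G (word A (a' # y # Z))"
  proof -
    have "total_cost (\<lambda>A ax. G (word A ax)) (remove_cand a Q @ [A]) (y # a' # Z)
        \<le> total_cost (\<lambda>A ax. G (word A ax)) (remove_cand a Q @ [A]) (a' # y # Z)"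
      using sel ax2(2) mem_rule_iff[OF c' profR(2)] by blast
    then show ?thesis
      using total_cost_eq_0_iff[OF c' profR(1) ax2(1)] total_cost_eq_0_iff[OF c' profR(1) ax2(2)] conR
      by simp
  qed
  moreover have "G (word A (y # a' # Z)) = G (star n)"
    using G_eq_star[of "word A (y # a' # Z)" n] assms A AZ k by auto
  moreover have "G (word A (a' # y # Z)) = G (False # star n)"
    using G_eq_star[of "word A (a' # y # Z)" n] assms A AZ k by auto
  ultimately show False using lt by simp
qed

lemma induced_on_hole_cost:
  assumes "finite C"
  shows "induced_on f C (hole_cost (\<lambda>n. G (star n)) (\<lambda>n. G (False # star n)))" (is "induced_on f C ?h")
proof (cases "3 \<le> card C")
  case True
  note c = G_normal[OF assms True]
  have "?h A ax = G (word A ax)" if A: "A \<noteq> {}" "A \<subseteq> C" and ax: "is_axis C ax" for A ax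
  proof (cases "is_interval A ax")
    case True
    then show ?thesis using normal_costD(2)[OF c A ax] by (simp add: hole_cost_def)
  next
    case False
    then have "1 \<le> holes (word A ax)"
      using is_interval_iff_holes[of ax A] ax by (simp add: is_axis_def)
    moreover have "ax \<noteq> []" using A ax by (auto simp: is_axis_def)
    then have "hd (word A ax) \<longleftrightarrow> hd ax \<in> A" "last (word A ax) \<longleftrightarrow> last ax \<in> A"
      by (simp_all add: word_def hd_map last_map)
    ultimately show ?thesis
      using G_eq_star[OF refl, of "word A ax"] False by (simp add: hole_cost_def num_holes_word)
  qed
  then show ?thesis using normal_cost_cong[OF c, of ?h] by (simp add: normal_cost_def)
next
  case False
  \<comment> \<open>With at most two candidates nothing lies between two others, so every axis is
    selected and all costs are 0.\<close>
  have int: "is_interval A ax" if "is_axis C ax" for A ax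
    using is_axis_length[OF that] that False by (auto simp: is_axis_def is_interval_iff_nth)
  obtain ax0 where ax0: "is_axis C ax0"
    using assms finite_distinct_list unfolding is_axis_def by metis
  have "f C P = argmin_axes ?h C P" if P: "is_profile C P" for P
  proof -
    have con: "con C P = {ax. is_axis C ax}" using int by (auto simp: con_def)
    moreover have "con C P \<noteq> {}" using con ax0 by blast
    then have "f C P = con C P"
      using linearity[unfolded consistent_with_linearity_def linear_profile_def] assms P by blast
    moreover have "total_cost ?h P ax = 0" if "is_axis C ax" for ax
      using int[OF that] by (induction P) (auto simp: hole_cost_def)
    ultimately show ?thesis by (auto simp: argmin_axes_def)
  qed
  then show ?thesis by (simp add: induced_on_def)
qed

lemma G_pos:
  assumes "1 \<le> holes w" "3 \<le> length w"
  shows "0 < G w"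
proof -
  obtain ax :: "'a list" where ax: "distinct ax" "length ax = length w" using ex_fresh_list by blast
  obtain A where A: "A \<subseteq> set ax" "word A ax = w" using ex_word[of ax w] ax by auto
  have "\<not> is_interval A ax" using is_interval_iff_holes[OF ax(1), of A] A assms by simp
  then have "A \<noteq> {}" by (auto simp: is_interval_def)
  have axis: "is_axis (set ax) ax" using ax by (simp add: is_axis_def)
  have "3 \<le> card (set ax)" using ax assms by (simp add: distinct_card)
  then show ?thesis
    using normal_costD[OF G_normal \<open>A \<noteq> {}\<close> A(1) axis] \<open>\<not> is_interval A ax\<close> A by auto
qed

end

theorem mainTheorem20:
  fixes f :: "'a axis_rule"
  assumes "infinite (UNIV :: 'a set)"
    and "is_axis_rule f"
    and "scoring_rule f"
    and "neutral f"
    and "consistent_with_linearity f"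
    and "resistant_to_cloning f"
    and "inclusion_clearance f"
  shows "\<exists>hs h :: nat \<Rightarrow> real.
           (\<forall>n \<ge> 1. hs n > 0 \<and> h n > 0) \<and>
           (\<forall>C. finite C \<longrightarrow> induced_on f C (hole_cost hs h)) \<and>
           (\<forall>n \<ge> 1. hs n \<le> h n \<and> h n \<le> hs (n + 1))"
proof -
  interpret linear_scoring_rule f using assms by unfold_locales
  obtain G where "word_cost f G"
    using ex_global_word_cost linear_scoring_rule_axioms
    by (metis word_cost.intro word_cost_axioms.intro)
  then interpret word_cost f G .
  show ?thesis
    using G_pos[of "star _"] G_pos[of "False # star _"] induced_on_hole_cost G_star_le G_star_le_Suc
    by (intro exI[of _ "\<lambda>n. G (star n)"] exI[of _ "\<lambda>n. G (False # star n)"]) auto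
qed

end
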